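(* Let $R=K[x_1,\dots,x_n]$ be a polynomial ring over a field $K$, let $0\ne\lambda\in P_n$, $I=\mathrm{Sss}(\{\lambda\})$, $j'=\min\{i:\lambda_i>0\}$ and $P_j=(x_1,\dots,x_j)$ for $1\le j\le n$. Then $$\mathrm{Ass}^\infty(I)=\begin{cases}\{\sigma(P_j): j'\le j\le n,\ \sigma\in\mathfrak S_n\}&\text{if }j'>1,\\ \{\sigma(P_j): j=1\text{ or }(j>1\text{ and }\lambda_j\ne\lambda_1),\ \sigma\in\mathfrak S_n\}&\text{if }j'=1.\end{cases}$$ Moreover: (1) if either $\lambda=(a,\dots,a)$ for some $a\in\mathbb N$, or $\lambda$ has no repeated parts other than possibly repetitions of $\lambda_1$, then $\mathrm{astab}(I)=\mathrm{dstab}(I)=1$ and $I^k=I^{(k)_{\mathrm{Ass}}}$ for each $k\in\mathbb N$, $k\ge 1$; (2) otherwise, setting $s=\max\{j:\lambda_1<\lambda_{j-1}=\lambda_j\}$, one has $\mathrm{dstab}(I)\le\mathrm{astab}(I)\le\min\{n-1,\ s(s-1)+1\}$.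
   Context: $\mathfrak S_n$ acts on $R$ by permuting variables. $P_n=\{\lambda\in\mathbb Z^n: 0\le\lambda_1\le\cdots\le\lambda_n\}$, $x^\lambda=x_1^{\lambda_1}\cdots x_n^{\lambda_n}$. For an $\mathfrak S_n$-fixed monomial ideal $I$ put $P(I)=\{\lambda\in P_n: x^\lambda\in I\}$. An $\mathfrak S_n$-fixed monomial ideal $I$ is symmetric strongly shifted if for every $\lambda\in P(I)$ and $1\le i<j\le n$ with $\lambda_i<\lambda_j$ one has $x^\lambda x_i/x_j\in I$. $\mathrm{Sss}(\{\lambda\})$ is the smallest symmetric strongly shifted ideal containing $x^\lambda$. $\mathrm{Ass}(I)$ is the set of associated primes of $R/I$. By Brodmann, $\mathrm{Ass}(I^k)$ and $\mathrm{depth}(R/I^k)$ are constant for $k\gg0$. $\mathrm{astab}(I)$ is the smallest $k_0\ge1$ with $\mathrm{Ass}(I^k)=\mathrm{Ass}(I^{k_0})$ for all $k\ge k_0$, and $\mathrm{Ass}^\infty(I)=\mathrm{Ass}(I^{k_0})$ for this $k_0$. $\mathrm{dstab}(I)$ is the smallest $k_0\ge1$ with $\mathrm{depth}(R/I^k)=\mathrm{depth}(R/I^{k_0})$ for all $k\ge k_0$. The symbolic power is $I^{(k)_{\mathrm{Ass}}}=\bigcap_{P\in\mathrm{Ass}(I)}(I^kR_P\cap R)$. *)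

theory Defs
  imports
    "HOL-Library.Poly_Mapping"
    "HOL-Library.Extended_Nat"
    "HOL-Combinatorics.Permutations"
    "HOL-Computational_Algebra.Fraction_Field"
    "HOL-Algebra.Ideal_Product"
    "HOL-Algebra.QuotRing"
begin

section \<open>Polynomial rings in finitely many variables\<close>

type_synonym expo = "nat \<Rightarrow>\<^sub>0 nat"
type_synonym 'k mpol = "expo \<Rightarrow>\<^sub>0 'k"

text \<open>
  The type \<open>'k mpol\<close> is the polynomial ring over \<open>'k\<close> in the variables \<open>x\<^sub>0, x\<^sub>1, x\<^sub>2, \<dots>\<close>;
  the ring \<open>K[x\<^sub>1, \<dots>, x\<^sub>n]\<close> is its subring of polynomials that only involve \<open>x\<^sub>1, \<dots>, x\<^sub>n\<close>.
\<close>

definition poly_ring :: "nat \<Rightarrow> 'k::field mpol ring" where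
  "poly_ring n =
     \<lparr>carrier = {p. \<forall>\<mu>\<in>Poly_Mapping.keys p. Poly_Mapping.keys \<mu> \<subseteq> {1..n}},
      mult = (*), one = 1, zero = 0, add = (+)\<rparr>"

lemma cring_poly_ring: "cring (poly_ring n)"
proof -
  have add: "p + q \<in> carrier (poly_ring n)" if "p \<in> carrier (poly_ring n)" "q \<in> carrier (poly_ring n)" for p q :: "'a mpol"
    using that Poly_Mapping.keys_add[of p q] unfolding poly_ring_def by auto
  have neg: "- p \<in> carrier (poly_ring n)" if "p \<in> carrier (poly_ring n)" for p :: "'a mpol"
    using that unfolding poly_ring_def by simp
  have mul: "p * q \<in> carrier (poly_ring n)" if "p \<in> carrier (poly_ring n)" "q \<in> carrier (poly_ring n)" for p q :: "'a mpol"
  proof -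
    have "Poly_Mapping.keys \<mu> \<subseteq> {1..n}" if m: "\<mu> \<in> Poly_Mapping.keys (p * q)" for \<mu>
    proof -
      from m Poly_Mapping.keys_mult[of p q] obtain a b where ab: "\<mu> = a + b" "a \<in> Poly_Mapping.keys p" "b \<in> Poly_Mapping.keys q"
        by blast
      then have "Poly_Mapping.keys a \<subseteq> {1..n}" "Poly_Mapping.keys b \<subseteq> {1..n}"
        using \<open>p \<in> _\<close> \<open>q \<in> _\<close> unfolding poly_ring_def by auto
      then show ?thesis using ab Poly_Mapping.keys_add[of a b] by blast
    qed
    then show ?thesis unfolding poly_ring_def by simp
  qed
  have zero: "0 \<in> carrier (poly_ring n :: 'a mpol ring)"
    and one: "1 \<in> carrier (poly_ring n :: 'a mpol ring)"
    by (simp_all add: poly_ring_def)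
  have ops: "(\<otimes>\<^bsub>poly_ring n\<^esub>) = ((*) :: 'a mpol \<Rightarrow> _)" "(\<oplus>\<^bsub>poly_ring n\<^esub>) = ((+) :: 'a mpol \<Rightarrow> _)"
    "\<one>\<^bsub>poly_ring n\<^esub> = (1 :: 'a mpol)" "\<zero>\<^bsub>poly_ring n\<^esub> = (0 :: 'a mpol)"
    by (simp_all add: poly_ring_def)
  show ?thesis
  proof (rule cringI)
    show "abelian_group (poly_ring n :: 'a mpol ring)"
    proof (rule abelian_groupI, unfold ops)
      fix x :: "'a mpol" assume "x \<in> carrier (poly_ring n)"
      then show "\<exists>y\<in>carrier (poly_ring n). y + x = 0"
        by (intro bexI[of _ "- x"] neg) simp_all
    qed (simp_all add: add zero add.assoc add.commute)
    show "Group.comm_monoid (poly_ring n :: 'a mpol ring)"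
      by (rule comm_monoidI, unfold ops) (simp_all add: mul one mult.assoc mult.commute)
  qed (simp add: ops distrib_right)
qed

definition xpow :: "expo \<Rightarrow> 'k::field mpol" where
  "xpow \<mu> = Poly_Mapping.single \<mu> 1"

definition xvar :: "nat \<Rightarrow> 'k::field mpol" where
  "xvar i = xpow (Poly_Mapping.single i 1)"

definition vars_ideal :: "nat \<Rightarrow> nat \<Rightarrow> 'k::field mpol set" where
  "vars_ideal n j = Idl\<^bsub>poly_ring n\<^esub> (xvar ` {1..j})"

text \<open>
  The action of a permutation of the variables, \<open>x\<^sub>i \<mapsto> x\<^bsub>\<sigma> i\<^esub>\<close>: the coefficient of \<open>\<sigma> p\<close> at the
  exponent \<open>\<mu>\<close> is the coefficient of \<open>p\<close> at \<open>\<mu> \<circ> \<sigma>\<close>.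
\<close>

definition permute_vars :: "(nat \<Rightarrow> nat) \<Rightarrow> 'k::field mpol \<Rightarrow> 'k mpol" where
  "permute_vars \<sigma> = Poly_Mapping.map_key (Poly_Mapping.map_key \<sigma>)"

lemma permute_vars_xvar:
  assumes "\<sigma> permutes {1..n}"
  shows "permute_vars \<sigma> (xvar i) = xvar (\<sigma> i)"
proof -
  have bij: "bij \<sigma>" using assms by (rule permutes_bij)
  then have inj: "inj \<sigma>" by (rule bij_is_inj)
  have s: "Poly_Mapping.map_key \<sigma> (Poly_Mapping.single (\<sigma> i) 1) = (Poly_Mapping.single i 1 :: expo)"
    by (rule map_key_single[OF inj])
  have inj2: "inj (Poly_Mapping.map_key \<sigma> :: expo \<Rightarrow> expo)"
  proof (rule injI)
    fix a b :: expo assume e: "Poly_Mapping.map_key \<sigma> a = Poly_Mapping.map_key \<sigma> b"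
    show "a = b"
    proof (rule poly_mapping_eqI)
      fix k
      obtain k' where "k = \<sigma> k'" using bij by (metis bij_pointE)
      then show "Poly_Mapping.lookup a k = Poly_Mapping.lookup b k"
        using arg_cong[OF e, of "\<lambda>m. Poly_Mapping.lookup m k'"] map_key.rep_eq[OF inj] 
        by (simp add: map_key.rep_eq inj)
    qed
  qed
  show ?thesis unfolding permute_vars_def xvar_def xpow_def
    using map_key_single[OF inj2, of "Poly_Mapping.single (\<sigma> i) 1" 1] s by metis
qed


section \<open>Symmetric strongly shifted ideals\<close>

definition partitions :: "nat \<Rightarrow> expo set" where
  "partitions n =
     {\<mu>. Poly_Mapping.keys \<mu> \<subseteq> {1..n} \<and>
         (\<forall>i j. 1 \<le> i \<and> i \<le> j \<and> j \<le> n \<longrightarrow> Poly_Mapping.lookup \<mu> i \<le> Poly_Mapping.lookup \<mu> j)}"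

definition monomial_ideal :: "nat \<Rightarrow> 'k::field mpol set \<Rightarrow> bool" where
  "monomial_ideal n I \<longleftrightarrow>
     (\<exists>M. (\<forall>\<mu>\<in>M. Poly_Mapping.keys \<mu> \<subseteq> {1..n}) \<and> I = Idl\<^bsub>poly_ring n\<^esub> (xpow ` M))"

definition symmetric_monomial_ideal :: "nat \<Rightarrow> 'k::field mpol set \<Rightarrow> bool" where
  "symmetric_monomial_ideal n I \<longleftrightarrow>
     monomial_ideal n I \<and> (\<forall>\<sigma>. \<sigma> permutes {1..n} \<longrightarrow> permute_vars \<sigma> ` I = I)"

definition partitions_of :: "nat \<Rightarrow> 'k::field mpol set \<Rightarrow> expo set" where
  "partitions_of n I = {\<mu> \<in> partitions n. xpow \<mu> \<in> I}"

text \<open>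
  In the exchange condition the truncated subtraction of exponents is exact, because
  \<open>\<mu>\<^sub>i < \<mu>\<^sub>j\<close> forces \<open>\<mu>\<^sub>j > 0\<close>.
\<close>

definition symmetric_strongly_shifted :: "nat \<Rightarrow> 'k::field mpol set \<Rightarrow> bool" where
  "symmetric_strongly_shifted n I \<longleftrightarrow>
     symmetric_monomial_ideal n I \<and>
     (\<forall>\<mu>\<in>partitions_of n I. \<forall>i j.
        1 \<le> i \<and> i < j \<and> j \<le> n \<and> Poly_Mapping.lookup \<mu> i < Poly_Mapping.lookup \<mu> j \<longrightarrow>
        xpow (\<mu> + Poly_Mapping.single i 1 - Poly_Mapping.single j 1) \<in> I)"

definition Sss :: "nat \<Rightarrow> expo set \<Rightarrow> 'k::field mpol set" where
  "Sss n L = \<Inter> {J. symmetric_strongly_shifted n J \<and> xpow ` L \<subseteq> J}"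


section \<open>Associated primes, depth and stability indices\<close>

text \<open>For \<open>k = 0\<close> the power is the unit ideal.\<close>

definition ideal_power :: "('a, 'b) ring_scheme \<Rightarrow> 'a set \<Rightarrow> nat \<Rightarrow> 'a set" where
  "ideal_power R I k = I [^]\<^bsub>ideals_set R\<^esub> k"

text \<open>The prime ideals of \<open>R\<close> that are annihilators of elements of the \<open>R\<close>-module \<open>R/I\<close>.\<close>

definition Ass :: "('a, 'b) ring_scheme \<Rightarrow> 'a set \<Rightarrow> 'a set set" where
  "Ass R I =
     {P. primeideal P R \<and>
         (\<exists>y\<in>carrier (R Quot I).
            P = {f \<in> carrier R. (I +>\<^bsub>R\<^esub> f) \<otimes>\<^bsub>R Quot I\<^esub> y = \<zero>\<^bsub>R Quot I\<^esub>})}"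

definition nonzerodivisor :: "('a, 'b) ring_scheme \<Rightarrow> 'a \<Rightarrow> bool" where
  "nonzerodivisor A a \<longleftrightarrow> (\<forall>y\<in>carrier A. a \<otimes>\<^bsub>A\<^esub> y = \<zero>\<^bsub>A\<^esub> \<longrightarrow> y = \<zero>\<^bsub>A\<^esub>)"

text \<open>
  \<open>f\<^sub>1, \<dots>, f\<^sub>d\<close> is a regular sequence on \<open>R/I\<close> if \<open>R/(I + (f\<^sub>1, \<dots>, f\<^sub>d))\<close> is nonzero and each
  \<open>f\<^sub>i\<close> is a nonzerodivisor on \<open>R/(I + (f\<^sub>1, \<dots>, f\<^bsub>i-1\<^esub>))\<close>.
\<close>

definition regular_sequence :: "('a, 'b) ring_scheme \<Rightarrow> 'a set \<Rightarrow> 'a list \<Rightarrow> bool" where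
  "regular_sequence R I fs \<longleftrightarrow>
     set fs \<subseteq> carrier R \<and>
     Idl\<^bsub>R\<^esub> (I \<union> set fs) \<noteq> carrier R \<and>
     (\<forall>i<length fs.
        let J = Idl\<^bsub>R\<^esub> (I \<union> set (take i fs)) in nonzerodivisor (R Quot J) (J +>\<^bsub>R\<^esub> fs ! i))"

text \<open>
  The depth of \<open>R/I\<close> for \<open>R = K[x\<^sub>1, \<dots>, x\<^sub>n]\<close>, with respect to the maximal ideal
  \<open>(x\<^sub>1, \<dots>, x\<^sub>n)\<close>; only meaningful for homogeneous proper \<open>I\<close>.
\<close>

definition depth_quot :: "nat \<Rightarrow> 'k::field mpol set \<Rightarrow> enat" where
  "depth_quot n I =
     (SUP fs\<in>{fs. regular_sequence (poly_ring n) I fs \<and> set fs \<subseteq> vars_ideal n n}.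
        enat (length fs))"

definition astab :: "nat \<Rightarrow> 'k::field mpol set \<Rightarrow> nat" where
  "astab n I =
     (LEAST k0. 1 \<le> k0 \<and>
        (\<forall>k\<ge>k0. Ass (poly_ring n) (ideal_power (poly_ring n) I k) =
                Ass (poly_ring n) (ideal_power (poly_ring n) I k0)))"

definition Ass_inf :: "nat \<Rightarrow> 'k::field mpol set \<Rightarrow> 'k mpol set set" where
  "Ass_inf n I = Ass (poly_ring n) (ideal_power (poly_ring n) I (astab n I))"

definition dstab :: "nat \<Rightarrow> 'k::field mpol set \<Rightarrow> nat" where
  "dstab n I =
     (LEAST k0. 1 \<le> k0 \<and>
        (\<forall>k\<ge>k0. depth_quot n (ideal_power (poly_ring n) I k) =
                depth_quot n (ideal_power (poly_ring n) I k0)))"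


section \<open>Symbolic powers\<close>

text \<open>
  The localization \<open>R\<^sub>P\<close> of the domain \<open>R = K[x\<^sub>1, \<dots>, x\<^sub>n]\<close> at a prime \<open>P\<close>, as a subring of the
  field of fractions, and the contraction \<open>J R\<^sub>P \<inter> R\<close> of the extended ideal.
\<close>

definition local_ring :: "nat \<Rightarrow> 'k::field mpol set \<Rightarrow> 'k mpol fract ring" where
  "local_ring n P =
     \<lparr>carrier = {Fract a s | a s. a \<in> carrier (poly_ring n) \<and> s \<in> carrier (poly_ring n) - P},
      mult = (*), one = 1, zero = 0, add = (+)\<rparr>"

definition local_contraction :: "nat \<Rightarrow> 'k::field mpol set \<Rightarrow> 'k mpol set \<Rightarrow> 'k mpol set" where
  "local_contraction n P J =
     {f \<in> carrier (poly_ring n). Fract f 1 \<in> Idl\<^bsub>local_ring n P\<^esub> ((\<lambda>g. Fract g 1) ` J)}"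

definition symbolic_power :: "nat \<Rightarrow> 'k::field mpol set \<Rightarrow> nat \<Rightarrow> 'k mpol set" where
  "symbolic_power n I k =
     (\<Inter>P\<in>Ass (poly_ring n) I. local_contraction n P (ideal_power (poly_ring n) I k))"

end

theory Submission
  imports Defs
begin

text \<open>
  Let \<open>f m = \<lambda>\<^sub>1 + \<dots> + \<lambda>\<^sub>m\<close>. Since \<open>f\<close> is convex, the exponents of \<open>I\<^sup>k\<close> are the integer points \<open>\<mu>\<close> of a
  contrapolymatroid, \<open>\<mu>(A) \<ge> k f |A|\<close> for all \<open>A\<close>, so \<open>I\<^sup>k\<close> is the intersection of the primary ideals
  \<open>P\<^sub>A\<^bsup>k f |A|\<^esup>\<close>, where \<open>P\<^sub>A = (x\<^sub>i : i \<in> A)\<close>. Hence \<open>P\<^sub>A\<close> is associated to \<open>I\<^sup>k\<close> iff some \<open>g\<close> on \<open>A\<close> satisfies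
  all the inequalities for proper subsets of \<open>A\<close> and misses the one for \<open>A\<close> by exactly one. If
  \<open>\<lambda>\<^bsub>j-1\<^esub> < \<lambda>\<^sub>j\<close> with \<open>j = |A|\<close>, the exponent \<open>k\<lambda>\<close> lowered by one in its last entry is such a \<open>g\<close>; otherwise
  one exists as soon as \<open>\<lambda>\<^sub>1 < \<lambda>\<^sub>j\<close> and \<open>k \<ge> j - 1\<close>. The maximal ideal is associated to the high powers unless
  \<open>\<lambda>\<close> is constant, which gives depth \<open>0\<close>; for constant \<open>\<lambda>\<close> the ideal is principal, \<open>I = (g)\<close>, and
  \<open>R/(g)\<close> and \<open>R/(g\<^sup>k)\<close> have the same regular sequences.
\<close>

text \<open>Two inclusions carry the description of the exponents. A contrapolymatroid whose bounds
  depend on cardinality only is closed under the exchange; conversely, each point of the one given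
  by \<open>lam\<close> is reached from \<open>lam\<close> by adding units, by exchanges on sorted
  exponents and by permutations. The converse is proved for an arbitrary set closed under these
  moves, so it serves twice: for the exponents of any ideal competing in \<open>Sss\<close>, and for
  the sums of an exponent of I^k and one of I, which gives the integer decomposition behind the
  powers. If \<lambda>_j = \<lambda>_1 with j > 1, the inequality for |A| = j is a sum of the
  inequalities for singletons. Such A give no associated prime for any k, and the symbolic powers
  lose nothing without them. As this obstruction does not involve k, Ass is constant from any
  exponent on at which the construction reaches all remaining j. Only those j with \<lambda>_1 <
  \<lambda>_(j-1) = \<lambda>_j demand more than k \<ge> 1, namely k \<ge> j - 1. The largest of
  them is s, so astab is at most s - 1, which is at most n - 1 and at most s(s-1) + 1.\<close>

declare One_nat_def [simp del]

abbreviation (input) lookup :: "('a \<Rightarrow>\<^sub>0 'b::zero) \<Rightarrow> 'a \<Rightarrow> 'b" where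
  "lookup \<equiv> Poly_Mapping.lookup"

abbreviation (input) keys :: "('a \<Rightarrow>\<^sub>0 'b::zero) \<Rightarrow> 'a set" where
  "keys \<equiv> Poly_Mapping.keys"

abbreviation (input) single :: "'a \<Rightarrow> 'b::zero \<Rightarrow> 'a \<Rightarrow>\<^sub>0 'b" where
  "single \<equiv> Poly_Mapping.single"

abbreviation (input) permute_expo :: "(nat \<Rightarrow> nat) \<Rightarrow> expo \<Rightarrow> expo" where
  "permute_expo \<equiv> Poly_Mapping.map_key"

section \<open>Integer points of contrapolymatroids\<close>

definition expos :: "nat \<Rightarrow> expo set" where
  "expos n = {\<mu>. keys \<mu> \<subseteq> {1..n}}"

definition weight :: "nat set \<Rightarrow> expo \<Rightarrow> nat" where
  "weight A \<mu> = (\<Sum>i\<in>A. lookup \<mu> i)"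

text \<open>The bound sees only \<open>card B\<close>, which builds in the invariance under
  permutations. \<open>B = {}\<close> takes part, so the set is empty unless \<open>t 0 = 0\<close>;
  multiples of \<open>prefix_sum\<close> satisfy this.\<close>

definition contrapolymatroid :: "nat \<Rightarrow> (nat \<Rightarrow> nat) \<Rightarrow> expo set" where
  "contrapolymatroid n t = {\<mu> \<in> expos n. \<forall>B\<subseteq>{1..n}. t (card B) \<le> weight B \<mu>}"

lemma contrapolymatroidD: "\<mu> \<in> contrapolymatroid n t \<Longrightarrow> B \<subseteq> {1..n} \<Longrightarrow> t (card B) \<le> weight B \<mu>"
  by (simp add: contrapolymatroid_def)

definition prefix_sum :: "(nat \<Rightarrow> nat) \<Rightarrow> nat \<Rightarrow> nat" where
  "prefix_sum g m = (\<Sum>i\<in>{1..m}. g i)"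

lemma prefix_sum_0 [simp]: "prefix_sum g 0 = 0"
  by (simp add: prefix_sum_def)

lemma prefix_sum_Suc [simp]: "prefix_sum g (Suc m) = prefix_sum g m + g (Suc m)"
  by (simp add: prefix_sum_def)

lemma prefix_sum_mult: "prefix_sum (\<lambda>i. k * g i) m = k * prefix_sum g m"
  by (simp add: prefix_sum_def sum_distrib_left)

lemma weight_add: "weight A (\<mu> + \<nu>) = weight A \<mu> + weight A \<nu>"
  by (simp add: weight_def lookup_add sum.distrib)

lemma weight_single: "finite A \<Longrightarrow> weight A (single i c) = (if i \<in> A then c else 0)"
  unfolding weight_def by (simp add: lookup_single when_def)

lemma weight_empty [simp]: "weight {} \<mu> = 0"
  by (simp add: weight_def)

lemma expos_add: "\<mu> \<in> expos n \<Longrightarrow> \<nu> \<in> expos n \<Longrightarrow> \<mu> + \<nu> \<in> expos n"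
  unfolding expos_def using Poly_Mapping.keys_add[of \<mu> \<nu>] by auto

lemma expos_zero [simp]: "0 \<in> expos n"
  by (simp add: expos_def)

lemma expos_single: "i \<in> {1..n} \<Longrightarrow> single i c \<in> expos n"
  by (simp add: expos_def)

lemma expos_lookup_eq_0: "\<mu> \<in> expos n \<Longrightarrow> i \<notin> {1..n} \<Longrightarrow> lookup \<mu> i = 0"
  unfolding expos_def by (meson in_keys_iff mem_Collect_eq subsetD)

lemma partitions_expos: "\<mu> \<in> partitions n \<Longrightarrow> \<mu> \<in> expos n"
  by (simp add: partitions_def expos_def)

lemma expo_of_fun:
  obtains \<mu> where "\<mu> \<in> expos n" "\<And>i. i \<in> {1..n} \<Longrightarrow> lookup \<mu> i = g i"
proof -
  define \<mu> :: expo where "\<mu> = Abs_poly_mapping (\<lambda>i. if i \<in> {1..n} then g i else 0)"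
  have "lookup \<mu> = (\<lambda>i. if i \<in> {1..n} then g i else 0)"
    unfolding \<mu>_def by (rule lookup_Abs_poly_mapping) (rule finite_subset[of _ "{1..n}"], auto)
  then show thesis
    by (intro that[of \<mu>]) (auto simp: expos_def in_keys_iff split: if_splits)
qed

lemma lookup_permute_expo: "\<sigma> permutes {1..n} \<Longrightarrow> lookup (permute_expo \<sigma> \<mu>) i = lookup \<mu> (\<sigma> i)"
  by (simp add: map_key.rep_eq permutes_inj)

lemma permute_expo_expos:
  assumes "\<sigma> permutes {1..n}"
  shows "permute_expo \<sigma> \<mu> \<in> expos n \<longleftrightarrow> \<mu> \<in> expos n"
proof -
  have *: "\<mu> \<in> expos n \<longleftrightarrow> (\<forall>i. i \<notin> {1..n} \<longrightarrow> lookup \<mu> i = 0)" for \<mu>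
    unfolding expos_def by (auto simp: in_keys_iff subset_iff)
  show ?thesis
    unfolding * lookup_permute_expo[OF assms]
    using permutes_not_in[OF assms] by auto
qed

lemma weight_permute_expo:
  assumes "\<sigma> permutes {1..n}"
  shows "weight A (permute_expo \<sigma> \<mu>) = weight (\<sigma> ` A) \<mu>"
  unfolding weight_def lookup_permute_expo[OF assms]
  using sum.reindex[of \<sigma> A "lookup \<mu>"] assms by (simp add: permutes_inj_on)

lemma permute_expo_inverse:
  assumes "\<sigma> permutes {1..n}"
  shows "permute_expo (inv_into UNIV \<sigma>) (permute_expo \<sigma> \<mu>) = \<mu>" "permute_expo \<sigma> (permute_expo (inv_into UNIV \<sigma>) \<mu>) = \<mu>"
  by (rule poly_mapping_eqI; simp add: lookup_permute_expo[OF assms]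
      lookup_permute_expo[OF permutes_inv[OF assms]] permutes_inverses[OF assms])+

lemma permute_expo_inj: "\<sigma> permutes {1..n} \<Longrightarrow> inj (permute_expo \<sigma>)"
  by (metis injI permute_expo_inverse(1))

lemma permute_expo_contrapolymatroid:
  assumes "\<sigma> permutes {1..n}"
  shows "permute_expo \<sigma> \<mu> \<in> contrapolymatroid n t \<longleftrightarrow> \<mu> \<in> contrapolymatroid n t"
proof -
  have "permute_expo \<sigma> \<mu> \<in> contrapolymatroid n t" if \<sigma>: "\<sigma> permutes {1..n}" and "\<mu> \<in> contrapolymatroid n t" for \<sigma> \<mu>
  proof -
    have "t (card B) \<le> weight (\<sigma> ` B) \<mu>" if "B \<subseteq> {1..n}" for B
    proof -
      have "\<sigma> ` B \<subseteq> {1..n}" "card (\<sigma> ` B) = card B"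
        using that permutes_image[OF \<sigma>] permutes_inj_on[OF \<sigma>] by (auto simp: card_image)
      then show ?thesis using contrapolymatroidD[OF \<open>\<mu> \<in> _\<close>, of "\<sigma> ` B"] by simp
    qed
    then show ?thesis
      using that by (simp add: contrapolymatroid_def permute_expo_expos weight_permute_expo)
  qed
  from this[OF assms] this[OF permutes_inv[OF assms]] show ?thesis
    by (metis permute_expo_inverse(1)[OF assms])
qed

text \<open>The r-th smallest element of B is at least r. The induction adds the largest element b
  last, when at most b - 1 others are present.\<close>

lemma prefix_sum_le_sum:
  fixes g :: "nat \<Rightarrow> nat"
  assumes "B \<subseteq> {1..n}" and "mono_on {1..n} g"
  shows "prefix_sum g (card B) \<le> (\<Sum>i\<in>B. g i)"
proof -
  have "finite B" using assms(1) finite_subset by blast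
  then show ?thesis using assms(1)
  proof (induction B rule: finite_linorder_max_induct)
    case (insert b A)
    have "A \<subseteq> {1..<b}" using insert by auto
    then have "card A \<le> b - 1" using card_mono[of "{1..<b}" A] by simp
    moreover have "1 \<le> b" "b \<le> n" using insert by auto
    ultimately have "g (Suc (card A)) \<le> g b"
      by (intro mono_onD[OF assms(2)]) auto
    moreover have "b \<notin> A" using insert by auto
    ultimately show ?case using insert by simp
  qed simp
qed

lemma mono_on_partition: "\<mu> \<in> partitions n \<Longrightarrow> mono_on {1..n} (lookup \<mu>)"
  by (auto simp: partitions_def intro!: mono_onI)

lemma partitions_iff: "\<mu> \<in> partitions n \<longleftrightarrow> \<mu> \<in> expos n \<and> mono_on {1..n} (lookup \<mu>)"
  by (auto simp: partitions_def expos_def mono_on_def)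

text \<open>Among the sets of m indices, \<open>{1..m}\<close> is the lightest for a sorted
  exponent, so one inequality per cardinality decides.\<close>

lemma partition_contrapolymatroid_iff:
  assumes "\<mu> \<in> partitions n"
  shows "\<mu> \<in> contrapolymatroid n t \<longleftrightarrow> (\<forall>m\<le>n. t m \<le> prefix_sum (lookup \<mu>) m)"
proof
  assume \<mu>: "\<mu> \<in> contrapolymatroid n t"
  show "\<forall>m\<le>n. t m \<le> prefix_sum (lookup \<mu>) m"
  proof (intro allI impI)
    fix m assume "m \<le> n"
    then have "{1..m} \<subseteq> {1..n}" by auto
    with \<mu> have "t (card {1..m}) \<le> weight {1..m} \<mu>"
      unfolding contrapolymatroid_def by blast
    then show "t m \<le> prefix_sum (lookup \<mu>) m" by (simp add: weight_def prefix_sum_def)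
  qed
next
  assume a: "\<forall>m\<le>n. t m \<le> prefix_sum (lookup \<mu>) m"
  have "t (card B) \<le> weight B \<mu>" if "B \<subseteq> {1..n}" for B
  proof -
    have "card B \<le> n" using card_mono[OF _ that] by simp
    then show ?thesis
      using a prefix_sum_le_sum[OF that mono_on_partition[OF assms]] unfolding weight_def
      by (meson le_trans)
  qed
  then show "\<mu> \<in> contrapolymatroid n t"
    using partitions_expos[OF assms] by (simp add: contrapolymatroid_def)
qed

lemma contrapolymatroid_add:
  assumes "\<mu> \<in> contrapolymatroid n t" "\<kappa> \<in> expos n"
  shows "\<mu> + \<kappa> \<in> contrapolymatroid n t"
  using assms by (auto simp: contrapolymatroid_def expos_add weight_add intro: trans_le_add1)

lemma contrapolymatroid_add_add:
  assumes "\<mu> \<in> contrapolymatroid n s" "\<nu> \<in> contrapolymatroid n t"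
  shows "\<mu> + \<nu> \<in> contrapolymatroid n (\<lambda>m. s m + t m)"
  using assms by (auto simp: contrapolymatroid_def expos_add weight_add intro!: add_mono)

lemma lookup_shift:
  fixes \<mu> :: expo
  assumes "i \<noteq> j"
  shows "lookup (\<mu> + single i 1 - single j 1) l =
    (if l = i then lookup \<mu> l + 1 else if l = j then lookup \<mu> l - 1 else lookup \<mu> l)"
  using assms by (auto simp: lookup_minus lookup_add lookup_single when_def)

lemma expos_shift:
  assumes "\<mu> \<in> expos n" "i \<in> {1..n}"
  shows "\<mu> + single i 1 - single j 1 \<in> expos n"
  using assms unfolding expos_def
  by (auto simp: in_keys_iff lookup_minus lookup_add lookup_single when_def subset_iff split: if_splits)

text \<open>Only a set B with j but without i loses weight. Replacing j by i in B gives a strictly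
  lighter set of the same cardinality, so the inequality for B had a slack of at least one.\<close>

lemma contrapolymatroid_shift:
  assumes \<mu>: "\<mu> \<in> contrapolymatroid n t" and ij: "i \<in> {1..n}" "j \<in> {1..n}" "lookup \<mu> i < lookup \<mu> j"
  shows "\<mu> + single i 1 - single j 1 \<in> contrapolymatroid n t"
proof -
  let ?\<mu>' = "\<mu> + single i 1 - single j 1"
  have ne: "i \<noteq> j" using ij by auto
  \<comment> \<open>The balance is written with a unit added on both sides, which keeps truncated
    subtraction out of the weights.\<close>
  have "?\<mu>' + single j 1 = \<mu> + single i 1"
    using ij ne by (intro poly_mapping_eqI) (auto simp: lookup_add lookup_shift[OF ne] lookup_single when_def)
  then have w: "finite B \<Longrightarrow> weight B ?\<mu>' + (if j \<in> B then 1 else 0) = weight B \<mu> + (if i \<in> B then 1 else 0)" for B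
    using weight_add[of B ?\<mu>' "single j 1"] weight_add[of B \<mu> "single i 1"] by (simp add: weight_single)
  have "t (card B) \<le> weight B ?\<mu>'" if B: "B \<subseteq> {1..n}" for B
  proof (cases "j \<in> B \<and> i \<notin> B")
    case True
    have fin: "finite B" using B finite_subset by blast
    let ?C = "insert i (B - {j})"
    have "card ?C = card B"
      using True fin card.remove[of B j] card_insert_disjoint[of "B - {j}" i] by simp
    moreover have "?C \<subseteq> {1..n}" using B ij by auto
    ultimately have "t (card B) \<le> weight ?C \<mu>"
      using contrapolymatroidD[OF \<mu>, of ?C] by simp
    moreover have "weight ?C \<mu> = lookup \<mu> i + weight (B - {j}) \<mu>"
      using True fin by (simp add: weight_def)
    moreover have "weight B \<mu> = lookup \<mu> j + weight (B - {j}) \<mu>"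
      using True fin unfolding weight_def by (simp add: sum.remove)
    ultimately have "t (card B) + 1 \<le> weight B \<mu>"
      using ij(3) by linarith
    with w[OF fin] True show ?thesis by simp
  next
    case False
    have fin: "finite B" using B finite_subset by blast
    have "t (card B) \<le> weight B \<mu>" using B \<mu> unfolding contrapolymatroid_def by auto
    with w[OF fin] False show ?thesis by (auto split: if_splits)
  qed
  then show ?thesis
    using \<mu> expos_shift[OF _ ij(1)] by (simp add: contrapolymatroid_def)
qed

section \<open>Sorted exponents and sets closed under exchanges\<close>

lemma sorting_permutation:
  fixes g :: "nat \<Rightarrow> nat"
  shows "\<exists>\<sigma>. \<sigma> permutes {1..n} \<and> mono_on {1..n} (g \<circ> \<sigma>)"
proof (induction n arbitrary: g)
  case 0
  show ?case by (rule exI[of _ id]) (auto simp: mono_on_def)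
next
  case (Suc n)
  have "Max (g ` {1..Suc n}) \<in> g ` {1..Suc n}" by (intro Max_in) auto
  then obtain m where m1: "m \<in> {1..Suc n}" "Max (g ` {1..Suc n}) = g m" by blast
  then have m: "m \<in> {1..Suc n}" "\<And>i. i \<in> {1..Suc n} \<Longrightarrow> g i \<le> g m"
    by (auto simp flip: m1(2))
  \<comment> \<open>Swapping a maximum into the last position leaves the first n positions to the
    induction hypothesis, whose permutation fixes \<open>Suc n\<close>.\<close>
  define \<tau> where "\<tau> = transpose m (Suc n)"
  have \<tau>: "\<tau> permutes {1..Suc n}"
    unfolding \<tau>_def using m(1) by (intro permutes_swap_id) auto
  obtain \<sigma> where \<sigma>: "\<sigma> permutes {1..n}" "mono_on {1..n} ((g \<circ> \<tau>) \<circ> \<sigma>)"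
    using Suc.IH by blast
  have \<sigma>S: "\<sigma> permutes {1..Suc n}" using \<sigma>(1) by (rule permutes_subset) auto
  have \<sigma>n: "\<sigma> (Suc n) = Suc n" using \<sigma>(1) by (simp add: permutes_def)
  have p: "\<tau> \<circ> \<sigma> permutes {1..Suc n}" by (rule permutes_compose[OF \<sigma>S \<tau>])
  have top: "(g \<circ> (\<tau> \<circ> \<sigma>)) (Suc n) = g m" by (simp add: \<sigma>n \<tau>_def)
  have "mono_on {1..Suc n} (g \<circ> (\<tau> \<circ> \<sigma>))"
  proof (rule mono_onI)
    fix r s assume rs: "r \<in> {1..Suc n}" "s \<in> {1..Suc n}" "r \<le> s"
    show "(g \<circ> (\<tau> \<circ> \<sigma>)) r \<le> (g \<circ> (\<tau> \<circ> \<sigma>)) s"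
    proof (cases "s = Suc n")
      case True
      have "(\<tau> \<circ> \<sigma>) r \<in> {1..Suc n}" using p rs(1) by (meson permutes_in_image)
      then show ?thesis using m(2) top True by simp
    next
      case False
      then have "r \<in> {1..n}" "s \<in> {1..n}" using rs by auto
      then show ?thesis using mono_onD[OF \<sigma>(2) _ _ rs(3)] by simp
    qed
  qed
  with p show ?case by blast
qed

text \<open>
  A sorted \<open>\<nu> \<noteq> lam\<close> that dominates \<open>lam\<close> arises from another one with smaller prefix sums: lower
  the first entry at which the prefix sums differ, and raise the first later entry at which they
  agree again, if there is one.
\<close>

lemma partition_in_shift_closed:
  assumes lam: "lam \<in> partitions n" and S: "lam \<in> S"
    and up: "\<And>\<mu> i. \<mu> \<in> S \<Longrightarrow> i \<in> {1..n} \<Longrightarrow> \<mu> + single i 1 \<in> S"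
    and shift: "\<And>\<mu> i j. \<mu> \<in> S \<Longrightarrow> \<mu> \<in> partitions n \<Longrightarrow> 1 \<le> i \<Longrightarrow> i < j \<Longrightarrow> j \<le> n \<Longrightarrow>
      lookup \<mu> i < lookup \<mu> j \<Longrightarrow> \<mu> + single i 1 - single j 1 \<in> S"
    and \<nu>: "\<nu> \<in> partitions n" and dom: "\<And>m. m \<le> n \<Longrightarrow> prefix_sum (lookup lam) m \<le> prefix_sum (lookup \<nu>) m"
  shows "\<nu> \<in> S"
  using \<nu> dom
\<comment> \<open>Both moves keep every prefix sum at or below its old value and lower the one at m,
  so the total of the prefix sums drops.\<close>
proof (induction "\<Sum>m\<le>n. prefix_sum (lookup \<nu>) m" arbitrary: \<nu> rule: less_induct)
  case less
  note \<nu> = less.prems(1) and dom = less.prems(2)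
  let ?f = "\<lambda>m. prefix_sum (lookup lam) m"
  show ?case
  proof (cases "\<forall>m\<le>n. prefix_sum (lookup \<nu>) m = ?f m")
    case True
    have "lookup \<nu> i = lookup lam i" for i
    proof (cases "i \<in> {1..n}")
      case i: True
      then obtain l where l: "i = Suc l" by (cases i) auto
      have "Suc l \<le> n" using i l by simp
      then have "prefix_sum (lookup \<nu>) (Suc l) = ?f (Suc l)" "prefix_sum (lookup \<nu>) l = ?f l"
        using True by (blast intro: Suc_leD)+
      then show ?thesis unfolding l prefix_sum_Suc by linarith
    next
      case False
      then show ?thesis using expos_lookup_eq_0 partitions_expos lam \<nu> by metis
    qed
    then have "\<nu> = lam" by (intro poly_mapping_eqI) auto
    then show ?thesis using S by simp
  next
    case False
    define m where "m = (LEAST m. m \<le> n \<and> prefix_sum (lookup \<nu>) m \<noteq> ?f m)"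
    have m: "m \<le> n" "prefix_sum (lookup \<nu>) m \<noteq> ?f m"
      using LeastI_ex[of "\<lambda>m. m \<le> n \<and> prefix_sum (lookup \<nu>) m \<noteq> ?f m"] False
      unfolding m_def by auto
    have below: "prefix_sum (lookup \<nu>) l = ?f l" if "l < m" for l
      using not_less_Least[of l "\<lambda>m. m \<le> n \<and> prefix_sum (lookup \<nu>) m \<noteq> ?f m"] that m(1)
      unfolding m_def[symmetric] by auto
    have m1: "1 \<le> m" using m(2) by (cases m) auto
    have gtm: "?f m < prefix_sum (lookup \<nu>) m" using m dom[of m] by simp
    obtain l where l: "m = Suc l" using m1 by (cases m) auto
    have num: "lookup lam m < lookup \<nu> m" using gtm below[of l] l by simp
    \<comment> \<open>Agreement below m gives \<nu>_(m-1) = lam_(m-1) \<le> lam_m < \<nu>_m, which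
      is why lowering entry m leaves the exponent sorted.\<close>
    have prev: "lookup \<nu> i = lookup lam i" if "1 \<le> i" "i < m" for i
      using below[of i] below[of "i - 1"] that by (cases i) auto
    have lmono: "lookup lam i \<le> lookup lam j" if "1 \<le> i" "i \<le> j" "j \<le> n" for i j
      using that lam by (auto simp: partitions_def)
    have nmono: "lookup \<nu> i \<le> lookup \<nu> j" if "1 \<le> i" "i \<le> j" "j \<le> n" for i j
      using that \<nu> by (auto simp: partitions_def)
    show ?thesis
    proof (cases "\<exists>q. m < q \<and> q \<le> n \<and> prefix_sum (lookup \<nu>) q = ?f q")
      case False
      then have gt: "?f q < prefix_sum (lookup \<nu>) q" if "m \<le> q" "q \<le> n" for q
        using that dom[of q] gtm by (metis le_neq_implies_less)
      define \<nu>' where "\<nu>' = \<nu> - single m 1"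
      have eq: "\<nu> = \<nu>' + single m 1"
        unfolding \<nu>'_def using num
        by (intro poly_mapping_eqI) (auto simp: lookup_add lookup_minus lookup_single when_def)
      have lk: "lookup \<nu>' i = (if i = m then lookup \<nu> i - 1 else lookup \<nu> i)" for i
        unfolding \<nu>'_def by (auto simp: lookup_minus lookup_single when_def)
      have part: "\<nu>' \<in> partitions n"
      proof -
        have "lookup \<nu>' i \<le> lookup \<nu>' j" if ij: "1 \<le> i" "i \<le> j" "j \<le> n" for i j
          using nmono[OF ij] num prev[of i] ij lmono[of i m] m(1) unfolding lk
          by (cases "i = m"; cases "j = m") (auto intro: diff_le_self le_trans)
        moreover have "\<nu>' \<in> expos n"
          using partitions_expos[OF \<nu>] unfolding expos_def \<nu>'_def
          by (auto simp: in_keys_iff lookup_minus subset_iff)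
        ultimately show ?thesis by (auto simp: partitions_iff mono_on_def)
      qed
      have ps: "prefix_sum (lookup \<nu>) q = prefix_sum (lookup \<nu>') q + (if m \<le> q then 1 else 0)" for q
        using num m1 by (induction q) (auto simp: lk)
      have "?f q \<le> prefix_sum (lookup \<nu>') q" if "q \<le> n" for q
        using ps[of q] gt[of q] dom[OF that] that by (auto split: if_splits)
      moreover have "(\<Sum>q\<le>n. prefix_sum (lookup \<nu>') q) < (\<Sum>q\<le>n. prefix_sum (lookup \<nu>) q)"
        using ps m(1) by (intro sum_strict_mono_ex1) auto
      ultimately have "\<nu>' \<in> S" using less.hyps part by blast
      then show ?thesis using up[of \<nu>' m] m1 m(1) eq by simp
    next
      case True
      define q where "q = (LEAST q. m < q \<and> q \<le> n \<and> prefix_sum (lookup \<nu>) q = ?f q)"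
      have q: "m < q" "q \<le> n" "prefix_sum (lookup \<nu>) q = ?f q"
        using LeastI_ex[OF True] unfolding q_def by auto
      have gt: "?f i < prefix_sum (lookup \<nu>) i" if "m \<le> i" "i < q" for i
        using not_less_Least[of i "\<lambda>q. m < q \<and> q \<le> n \<and> prefix_sum (lookup \<nu>) q = ?f q"] that
          dom[of i] gtm q unfolding q_def[symmetric]
        by (metis le_neq_implies_less less_imp_le_nat le_trans)
      obtain r where r: "q = Suc r" using q(1) by (cases q) auto
      have nuq: "lookup \<nu> q < lookup lam q" using gt[of r] q r by simp
      \<comment> \<open>Equal prefix sums at q and domination at q + 1 compare the next entries.
        With \<nu>_q < lam_q this leaves room to raise entry q.\<close>
      have next': "lookup lam j \<le> lookup \<nu> j" if "j = Suc q" "j \<le> n" for j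
        using dom[of j] that q by simp
      have after: "lookup \<nu> q < lookup \<nu> j" if "q < j" "j \<le> n" for j
        using nuq lmono[of q "Suc q"] next'[of "Suc q"] nmono[of "Suc q" j] that q m1 by simp
      define \<nu>' where "\<nu>' = \<nu> + single q 1 - single m 1"
      have ne: "q \<noteq> m" using q by simp
      have lk: "lookup \<nu>' i = (if i = q then lookup \<nu> i + 1 else if i = m then lookup \<nu> i - 1 else lookup \<nu> i)" for i
        unfolding \<nu>'_def by (rule lookup_shift[OF ne])
      have eq: "\<nu> = \<nu>' + single m 1 - single q 1"
        using ne num by (intro poly_mapping_eqI) (auto simp: lk lookup_shift)
      have part: "\<nu>' \<in> partitions n"
      proof -
        have "lookup \<nu>' i \<le> lookup \<nu>' j" if ij: "1 \<le> i" "i \<le> j" "j \<le> n" for i j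
        proof (cases "i = q")
          case True
          then show ?thesis using after[of j] ij q unfolding lk by auto
        next
          case iq: False
          have "lookup \<nu> i \<le> lookup \<nu> m - 1" if "j = m" "i \<noteq> m"
            using that prev[of i] lmono[of i m] num ij by simp
          then show ?thesis using nmono[OF ij] iq unfolding lk
            by (auto intro: diff_le_self le_trans)
        qed
        moreover have "\<nu>' \<in> expos n"
          unfolding \<nu>'_def using q m1 by (intro expos_shift partitions_expos[OF \<nu>]) auto
        ultimately show ?thesis by (auto simp: partitions_iff mono_on_def)
      qed
      have ps: "prefix_sum (lookup \<nu>) i = prefix_sum (lookup \<nu>') i + (if m \<le> i \<and> i < q then 1 else 0)" for i
        using num m1 q(1) by (induction i) (auto simp: lk)
      have "?f i \<le> prefix_sum (lookup \<nu>') i" if "i \<le> n" for i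
        using ps[of i] gt[of i] dom[OF that] that by (auto split: if_splits)
      moreover have "(\<Sum>q\<le>n. prefix_sum (lookup \<nu>') q) < (\<Sum>q\<le>n. prefix_sum (lookup \<nu>) q)"
        using ps m(1) q by (intro sum_strict_mono_ex1) auto
      ultimately have "\<nu>' \<in> S" using less.hyps part by blast
      \<comment> \<open>The exchange leading from \<nu>' back to \<nu> raises m and lowers q; it is
        admissible because m < q carries the smaller entry.\<close>
      moreover have "lookup \<nu>' m < lookup \<nu>' q"
        using nmono[of m q] num q m1 ne unfolding lk by simp
      ultimately show ?thesis using shift[of \<nu>' m q] part m1 q eq by simp
    qed
  qed
qed

text \<open>Sort, apply the sorted case, permute back. \<open>shift\<close> is assumed for sorted
  exponents only, as in the definition of symmetric strongly shifted ideals; S is arbitrary so as to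
  fit both an ideal and a set of sums.\<close>

lemma contrapolymatroid_subset_shift_closed:
  assumes lam: "lam \<in> partitions n" and S: "lam \<in> S"
    and up: "\<And>\<mu> i. \<mu> \<in> S \<Longrightarrow> i \<in> {1..n} \<Longrightarrow> \<mu> + single i 1 \<in> S"
    and shift: "\<And>\<mu> i j. \<mu> \<in> S \<Longrightarrow> \<mu> \<in> partitions n \<Longrightarrow> 1 \<le> i \<Longrightarrow> i < j \<Longrightarrow> j \<le> n \<Longrightarrow>
      lookup \<mu> i < lookup \<mu> j \<Longrightarrow> \<mu> + single i 1 - single j 1 \<in> S"
    and perm: "\<And>\<sigma> \<mu>. \<sigma> permutes {1..n} \<Longrightarrow> \<mu> \<in> S \<Longrightarrow> permute_expo \<sigma> \<mu> \<in> S"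
  shows "contrapolymatroid n (prefix_sum (lookup lam)) \<subseteq> S"
proof
  fix \<nu> assume \<nu>: "\<nu> \<in> contrapolymatroid n (prefix_sum (lookup lam))"
  obtain \<sigma> where \<sigma>: "\<sigma> permutes {1..n}" "mono_on {1..n} (lookup \<nu> \<circ> \<sigma>)"
    using sorting_permutation by blast
  have "lookup (permute_expo \<sigma> \<nu>) = lookup \<nu> \<circ> \<sigma>"
    by (rule ext) (simp add: lookup_permute_expo[OF \<sigma>(1)])
  moreover have "\<nu> \<in> expos n" using \<nu> by (simp add: contrapolymatroid_def)
  ultimately have part: "permute_expo \<sigma> \<nu> \<in> partitions n"
    by (simp add: partitions_iff permute_expo_expos[OF \<sigma>(1)] \<sigma>(2))
  have "permute_expo \<sigma> \<nu> \<in> contrapolymatroid n (prefix_sum (lookup lam))"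
    using \<nu> by (simp add: permute_expo_contrapolymatroid[OF \<sigma>(1)])
  then have "permute_expo \<sigma> \<nu> \<in> S"
    using partition_in_shift_closed[OF lam S up shift part] partition_contrapolymatroid_iff[OF part] by blast
  from perm[OF permutes_inv[OF \<sigma>(1)] this] show "\<nu> \<in> S"
    by (simp add: permute_expo_inverse[OF \<sigma>(1)])
qed

lemma partition_mem_contrapolymatroid:
  "lam \<in> partitions n \<Longrightarrow> lam \<in> contrapolymatroid n (prefix_sum (lookup lam))"
  by (simp add: partition_contrapolymatroid_iff)

text \<open>Integer decomposition. The set of sums contains (k+1) lam and inherits all closure
  properties, so it contains the whole contrapolymatroid of (k+1) lam; no splitting is constructed
  explicitly.\<close>

lemma contrapolymatroid_split:
  assumes lam: "lam \<in> partitions n"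
  defines "f \<equiv> prefix_sum (lookup lam)"
  assumes \<nu>: "\<nu> \<in> contrapolymatroid n (\<lambda>m. Suc k * f m)"
  obtains \<alpha> \<beta> where "\<nu> = \<alpha> + \<beta>" "\<alpha> \<in> contrapolymatroid n (\<lambda>m. k * f m)" "\<beta> \<in> contrapolymatroid n f"
proof -
  let ?A = "contrapolymatroid n (\<lambda>m. k * f m)" and ?B = "contrapolymatroid n f"
  define S where "S = {\<alpha> + \<beta> | \<alpha> \<beta>. \<alpha> \<in> ?A \<and> \<beta> \<in> ?B}"
  have scaled: "\<exists>\<mu> \<in> partitions n. lookup \<mu> = (\<lambda>i. c * lookup lam i)" for c
  proof -
    obtain \<mu> where \<mu>: "\<mu> \<in> expos n" "\<And>i. i \<in> {1..n} \<Longrightarrow> lookup \<mu> i = c * lookup lam i"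
      by (rule expo_of_fun[of n "\<lambda>i. c * lookup lam i"]) blast
    have lk: "lookup \<mu> = (\<lambda>i. c * lookup lam i)"
      using \<mu> expos_lookup_eq_0 partitions_expos[OF lam] by (metis mult_0_right)
    moreover have "\<mu> \<in> partitions n"
      using \<mu>(1) lam unfolding partitions_iff lk by (auto simp: mono_on_def)
    ultimately show ?thesis by blast
  qed
  obtain \<mu> where \<mu>: "\<mu> \<in> partitions n" "lookup \<mu> = (\<lambda>i. Suc k * lookup lam i)" using scaled by blast
  obtain \<kappa> where \<kappa>: "\<kappa> \<in> partitions n" "lookup \<kappa> = (\<lambda>i. k * lookup lam i)" using scaled by blast
  have "\<mu> = \<kappa> + lam" by (rule poly_mapping_eqI) (simp add: \<mu> \<kappa> lookup_add)
  moreover have "\<kappa> \<in> ?A"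
    using partition_mem_contrapolymatroid[OF \<kappa>(1)] unfolding \<kappa>(2) f_def by (simp add: prefix_sum_mult[abs_def])
  moreover have "lam \<in> ?B" using partition_mem_contrapolymatroid[OF lam] by (simp add: f_def)
  ultimately have "\<mu> \<in> S" unfolding S_def by blast
  then have "contrapolymatroid n (prefix_sum (lookup \<mu>)) \<subseteq> S"
  proof (rule contrapolymatroid_subset_shift_closed[OF \<mu>(1)])
    fix \<mu> i assume "\<mu> \<in> S" "i \<in> {1..n}"
    then show "\<mu> + single i 1 \<in> S"
      unfolding S_def using contrapolymatroid_add[OF _ expos_single] by (auto simp: add.assoc) blast
  next
    fix \<mu> i j assume "\<mu> \<in> S" and ij: "1 \<le> i" "i < j" "j \<le> n" "lookup \<mu> i < lookup \<mu> j"
    then obtain \<alpha> \<beta> where \<mu>: "\<mu> = \<alpha> + \<beta>" "\<alpha> \<in> ?A" "\<beta> \<in> ?B" unfolding S_def by blast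
    have *: "(\<alpha> + \<beta>) + single i 1 - single j 1 = (\<alpha> + single i 1 - single j 1) + \<beta>"
      if "lookup \<alpha> i < lookup \<alpha> j" for \<alpha> \<beta> :: expo
      using ij(2) that by (intro poly_mapping_eqI) (auto simp: lookup_shift lookup_add)
    \<comment> \<open>A strict inequality between sums is strict for one of the summands, and the
      exchange is made there. That summand may be unsorted, which
      \<open>contrapolymatroid_shift\<close> permits.\<close>
    consider "lookup \<alpha> i < lookup \<alpha> j" | "lookup \<beta> i < lookup \<beta> j"
      using ij(4) unfolding \<mu>(1) lookup_add by linarith
    then show "\<mu> + single i 1 - single j 1 \<in> S"
    proof cases
      case 1
      then have "\<alpha> + single i 1 - single j 1 \<in> ?A" using ij \<mu> by (intro contrapolymatroid_shift) auto
      with *[OF 1] show ?thesis unfolding S_def \<mu>(1) using \<mu>(3) by blast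
    next
      case 2
      then have "\<beta> + single i 1 - single j 1 \<in> ?B" using ij \<mu> by (intro contrapolymatroid_shift) auto
      moreover have "\<mu> + single i 1 - single j 1 = \<alpha> + (\<beta> + single i 1 - single j 1)"
        using *[OF 2, of \<alpha>] by (simp only: \<mu>(1) add.commute)
      ultimately show ?thesis unfolding S_def using \<mu>(2) by blast
    qed
  next
    fix \<sigma> \<mu> assume \<sigma>: "\<sigma> permutes {1..n}" and "\<mu> \<in> S"
    have "permute_expo \<sigma> (\<alpha> + \<beta>) = permute_expo \<sigma> \<alpha> + permute_expo \<sigma> \<beta>" for \<alpha> \<beta>
      by (rule map_key_plus[OF permutes_inj[OF \<sigma>]])
    with \<open>\<mu> \<in> S\<close> show "permute_expo \<sigma> \<mu> \<in> S"
      unfolding S_def using permute_expo_contrapolymatroid[OF \<sigma>] by blast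
  qed
  moreover have "prefix_sum (lookup \<mu>) = (\<lambda>m. Suc k * f m)"
    unfolding \<mu>(2) f_def by (rule ext) (rule prefix_sum_mult)
  ultimately have "\<nu> \<in> S" using \<nu> by auto
  then show thesis using that unfolding S_def by blast
qed

section \<open>Ideals in commutative rings\<close>

lemma (in cring) cring_idealI:
  assumes "I \<subseteq> carrier R" "\<zero> \<in> I" "\<And>x y. x \<in> I \<Longrightarrow> y \<in> I \<Longrightarrow> x \<oplus> y \<in> I"
    and mult: "\<And>r x. r \<in> carrier R \<Longrightarrow> x \<in> I \<Longrightarrow> r \<otimes> x \<in> I"
  shows "ideal I R"
proof (rule idealI[OF ring_axioms])
  show "subgroup I (add_monoid R)"
  proof (rule add.subgroupI)
    fix a assume "a \<in> I"
    then have "\<ominus> \<one> \<otimes> a \<in> I" "\<ominus> \<one> \<otimes> a = \<ominus> a" using assms(1) by (auto simp: mult l_minus)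
    then show "\<ominus> a \<in> I" by simp
  qed (use assms in auto)
next
  fix a x assume "a \<in> I" "x \<in> carrier R"
  moreover from this have "a \<otimes> x = x \<otimes> a" using assms(1) by (intro m_comm) auto
  ultimately show "x \<otimes> a \<in> I" "a \<otimes> x \<in> I" using mult by auto
qed

lemma (in cring) rcos_eq_ideal_iff:
  assumes "ideal J R" "a \<in> carrier R"
  shows "J +> a = J \<longleftrightarrow> a \<in> J"
  using assms a_rcos_zero ideal.rcos_const_imp_mem by metis

lemma (in cring) carrier_Quot: "carrier (R Quot J) = {J +> y | y. y \<in> carrier R}"
  by (auto simp: FactRing_def A_RCOSETS_def' )

lemma (in cring) nonzerodivisor_Quot_iff:
  assumes "ideal J R" "a \<in> carrier R"
  shows "nonzerodivisor (R Quot J) (J +> a) \<longleftrightarrow> (\<forall>y\<in>carrier R. a \<otimes> y \<in> J \<longrightarrow> y \<in> J)"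
proof -
  have "(J +> a) \<otimes>\<^bsub>R Quot J\<^esub> (J +> y) = J +> (a \<otimes> y)" if "y \<in> carrier R" for y
    using ideal.rcoset_mult_add[OF assms(1) assms(2) that] by (simp add: FactRing_def)
  moreover have "\<zero>\<^bsub>R Quot J\<^esub> = J" by (simp add: FactRing_def)
  ultimately show ?thesis
    unfolding nonzerodivisor_def carrier_Quot using rcos_eq_ideal_iff[OF assms(1)] assms(2)
    by (auto; metis m_closed)
qed

text \<open>Coset arithmetic turns an annihilator in the quotient into a colon ideal J : y inside
  R.\<close>

lemma (in cring) Ass_iff:
  assumes "ideal J R"
  shows "P \<in> Ass R J \<longleftrightarrow> primeideal P R \<and> (\<exists>y\<in>carrier R. P = {f \<in> carrier R. f \<otimes> y \<in> J})"
proof -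
  have "(J +> f) \<otimes>\<^bsub>R Quot J\<^esub> (J +> y) = \<zero>\<^bsub>R Quot J\<^esub> \<longleftrightarrow> f \<otimes> y \<in> J"
    if "f \<in> carrier R" "y \<in> carrier R" for f y
    using ideal.rcoset_mult_add[OF assms that] rcos_eq_ideal_iff[OF assms, of "f \<otimes> y"] that
    by (simp add: FactRing_def)
  then have "{f \<in> carrier R. (J +> f) \<otimes>\<^bsub>R Quot J\<^esub> (J +> y) = \<zero>\<^bsub>R Quot J\<^esub>} = {f \<in> carrier R. f \<otimes> y \<in> J}"
    if "y \<in> carrier R" for y using that by auto
  then show ?thesis unfolding Ass_def carrier_Quot by auto
qed

text \<open>If each of the finitely many colon ideals had an element outside P, the product of these
  elements would lie in all of them, hence in P, against primality.\<close>

lemma (in cring) prime_eq_colon: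
  assumes P: "primeideal P R" and fin: "finite F" and Q: "\<And>A. A \<in> F \<Longrightarrow> ideal (Q A) R"
    and y: "y \<in> carrier R" and eq: "P = {f \<in> carrier R. \<forall>A\<in>F. f \<otimes> y \<in> Q A}"
  obtains A where "A \<in> F" "P = {f \<in> carrier R. f \<otimes> y \<in> Q A}"
proof -
  have one: "\<one> \<notin> P"
    using P ideal.one_imp_carrier primeideal.I_notcarr primeideal.axioms(1) by metis
  have "\<exists>A\<in>F. \<forall>f\<in>carrier R. f \<otimes> y \<in> Q A \<longrightarrow> f \<in> P"
  proof (rule ccontr)
    assume "\<not> ?thesis"
    then have ex: "\<And>A. A \<in> F \<Longrightarrow> \<exists>f\<in>carrier R. f \<otimes> y \<in> Q A \<and> f \<notin> P" by blast
    have "\<exists>f\<in>carrier R. f \<notin> P \<and> (\<forall>A\<in>F. f \<otimes> y \<in> Q A)"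
      using fin ex Q
    proof (induction F rule: finite_induct)
      case empty
      show ?case using one by blast
    next
      case (insert A F)
      have "\<exists>f\<in>carrier R. f \<notin> P \<and> (\<forall>A\<in>F. f \<otimes> y \<in> Q A)"
        by (rule insert.IH) (use insert.prems in auto)
      then obtain f where f: "f \<in> carrier R" "f \<notin> P" "\<And>B. B \<in> F \<Longrightarrow> f \<otimes> y \<in> Q B"
        by blast
      obtain h where h: "h \<in> carrier R" "h \<notin> P" "h \<otimes> y \<in> Q A"
        using insert.prems(1)[of A] by auto
      have "h \<otimes> f \<notin> P" using f h primeideal.I_prime[OF P] by blast
      moreover have "h \<otimes> f \<otimes> y \<in> Q B" if "B \<in> F" for B
        using f(1) h(1) y ideal.I_l_closed[OF insert.prems(2)[of B] f(3)[OF that] h(1)] that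
        by (simp add: m_assoc)
      moreover have "h \<otimes> f \<otimes> y \<in> Q A"
      proof -
        have "h \<otimes> f \<otimes> y = f \<otimes> (h \<otimes> y)" using f(1) h(1) y by (simp add: m_ac)
        then show ?thesis using ideal.I_l_closed[OF insert.prems(2)[of A] h(3) f(1)] by simp
      qed
      ultimately show ?case using f(1) h(1) by (intro bexI[of _ "h \<otimes> f"]) auto
    qed
    then show False using eq by blast
  qed
  then obtain A where "A \<in> F" "\<forall>f\<in>carrier R. f \<otimes> y \<in> Q A \<longrightarrow> f \<in> P" by blast
  moreover from this eq have "P = {f \<in> carrier R. f \<otimes> y \<in> Q A}" by blast
  ultimately show thesis using that by blast
qed

lemma (in cring) Idl_Un:
  assumes "S \<subseteq> carrier R" "T \<subseteq> carrier R"
  shows "Idl (S \<union> T) = Idl S <+> Idl T"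
proof -
  have "Idl (S \<union> T) = Idl (Idl S \<union> Idl T)"
  proof (rule subset_antisym)
    show "Idl (S \<union> T) \<subseteq> Idl (Idl S \<union> Idl T)"
      using genideal_self[OF assms(1)] genideal_self[OF assms(2)]
        genideal_ideal[OF assms(1)] genideal_ideal[OF assms(2)]
      by (intro subset_Idl_subset) (auto dest: ideal.Icarr)
    show "Idl (Idl S \<union> Idl T) \<subseteq> Idl (S \<union> T)"
      using assms by (intro genideal_minimal genideal_ideal Un_least subset_Idl_subset) auto
  qed
  then show ?thesis
    using union_genideal[OF genideal_ideal[OF assms(1)] genideal_ideal[OF assms(2)]] by simp
qed

lemma (in cring) Idl_ideal: "ideal J R \<Longrightarrow> Idl J = J"
  using genideal_minimal genideal_self ideal.Icarr by (metis subset_antisym order_refl subsetI)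


section \<open>Monomial ideals\<close>

text \<open>For an \<open>upset\<close> this is a monomial ideal, and membership is a condition on
  the support, so questions on ideals become questions on exponent sets.\<close>

definition mon_span :: "expo set \<Rightarrow> 'k::field mpol set" where
  "mon_span S = {p. keys p \<subseteq> S}"

definition upset :: "nat \<Rightarrow> expo set \<Rightarrow> bool" where
  "upset n S \<longleftrightarrow> S \<subseteq> expos n \<and> (\<forall>\<mu>\<in>S. \<forall>\<kappa>\<in>expos n. \<mu> + \<kappa> \<in> S)"

text \<open>For A within \<open>{1..n}\<close> the span is the t-th power of (x_i : i in A), and t =
  1 gives the prime itself; for A = {} and t > 0 it is the zero ideal.\<close>

definition weight_ge :: "nat \<Rightarrow> nat set \<Rightarrow> nat \<Rightarrow> expo set" where
  "weight_ge n A t = {\<mu> \<in> expos n. t \<le> weight A \<mu>}"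

lemma upset_contrapolymatroid: "upset n (contrapolymatroid n t)"
  by (auto simp: upset_def contrapolymatroid_add) (simp add: contrapolymatroid_def)

lemma upset_weight_ge: "upset n (weight_ge n A t)"
  by (auto simp: upset_def weight_ge_def weight_add expos_add intro: trans_le_add1)

lemma poly_ring_ops [simp]:
  "mult (poly_ring n) = (*)" "add (poly_ring n) = (+)" "one (poly_ring n) = 1" "zero (poly_ring n) = 0"
  by (simp_all add: poly_ring_def)

lemma carrier_poly_ring: "carrier (poly_ring n) = mon_span (expos n)"
  by (auto simp: poly_ring_def mon_span_def expos_def)

lemma poly_ideal_iff:
  "ideal J (poly_ring n) \<longleftrightarrow> J \<subseteq> carrier (poly_ring n) \<and> 0 \<in> J \<and> (\<forall>p\<in>J. \<forall>q\<in>J. p + q \<in> J) \<and>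
     (\<forall>r\<in>carrier (poly_ring n). \<forall>p\<in>J. r * p \<in> J)" (is "?l \<longleftrightarrow> ?r")
proof
  interpret R: cring "poly_ring n" by (rule cring_poly_ring)
  show "?l" if ?r using that by (intro R.cring_idealI) auto
  show "?r" if ?l
  proof -
    interpret J: ideal J "poly_ring n" by fact
    show ?thesis
      using J.a_closed J.I_l_closed J.zero_closed J.a_subset by auto
  qed
qed

lemma carrier_poly_ring_closed:
  fixes p q :: "'k::field mpol"
  shows "(0 :: 'k mpol) \<in> carrier (poly_ring n)" "(1 :: 'k mpol) \<in> carrier (poly_ring n)"
  "p \<in> carrier (poly_ring n) \<Longrightarrow> q \<in> carrier (poly_ring n) \<Longrightarrow> p + q \<in> carrier (poly_ring n)"
  "p \<in> carrier (poly_ring n) \<Longrightarrow> q \<in> carrier (poly_ring n) \<Longrightarrow> p * q \<in> carrier (poly_ring n)"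
  "p \<in> carrier (poly_ring n) \<Longrightarrow> - p \<in> carrier (poly_ring n)"
  "p \<in> carrier (poly_ring n) \<Longrightarrow> q \<in> carrier (poly_ring n) \<Longrightarrow> p - q \<in> carrier (poly_ring n)"
  "p \<in> carrier (poly_ring n) \<Longrightarrow> p ^ k \<in> carrier (poly_ring n)"
proof -
  interpret R: cring "poly_ring n" by (rule cring_poly_ring)
  show 0: "(0 :: 'k mpol) \<in> carrier (poly_ring n)" and 1: "(1 :: 'k mpol) \<in> carrier (poly_ring n)"
    using R.zero_closed R.one_closed by simp_all
  show add: "p \<in> carrier (poly_ring n) \<Longrightarrow> q \<in> carrier (poly_ring n) \<Longrightarrow> p + q \<in> carrier (poly_ring n)" for p q :: "'k mpol"
    using R.a_closed by simp
  show mult: "p \<in> carrier (poly_ring n) \<Longrightarrow> q \<in> carrier (poly_ring n) \<Longrightarrow> p * q \<in> carrier (poly_ring n)" for p q :: "'k mpol"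
    using R.m_closed by simp
  show minus: "p \<in> carrier (poly_ring n) \<Longrightarrow> - p \<in> carrier (poly_ring n)" for p :: "'k mpol"
    by (simp add: carrier_poly_ring mon_span_def)
  show "p \<in> carrier (poly_ring n) \<Longrightarrow> q \<in> carrier (poly_ring n) \<Longrightarrow> p - q \<in> carrier (poly_ring n)"
    using add[OF _ minus, of p q] by simp
  show "p \<in> carrier (poly_ring n) \<Longrightarrow> p ^ k \<in> carrier (poly_ring n)"
    by (induction k) (auto intro: 1 mult)
qed

lemma poly_ideal_closed:
  assumes "ideal J (poly_ring n)"
  shows "0 \<in> J" "p \<in> J \<Longrightarrow> p \<in> carrier (poly_ring n)" "p \<in> J \<Longrightarrow> q \<in> J \<Longrightarrow> p + q \<in> J"
    "r \<in> carrier (poly_ring n) \<Longrightarrow> p \<in> J \<Longrightarrow> r * p \<in> J"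
    "p \<in> J \<Longrightarrow> - p \<in> J" "p \<in> J \<Longrightarrow> q \<in> J \<Longrightarrow> p - q \<in> J"
proof -
  show "0 \<in> J" "p \<in> J \<Longrightarrow> p \<in> carrier (poly_ring n)"
    using assms by (auto simp: poly_ideal_iff)
  show add: "p \<in> J \<Longrightarrow> q \<in> J \<Longrightarrow> p + q \<in> J" for p q
    using assms by (auto simp: poly_ideal_iff)
  show mult: "r \<in> carrier (poly_ring n) \<Longrightarrow> p \<in> J \<Longrightarrow> r * p \<in> J" for r p
    using assms by (auto simp: poly_ideal_iff)
  show minus: "p \<in> J \<Longrightarrow> - p \<in> J" for p
    using mult[OF carrier_poly_ring_closed(5)[OF carrier_poly_ring_closed(2)], of p] by simp
  show "p \<in> J \<Longrightarrow> q \<in> J \<Longrightarrow> p - q \<in> J"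
    using add[OF _ minus, of p q] by simp
qed

lemma poly_ideal_sum:
  assumes "ideal J (poly_ring n)" "\<And>i. i \<in> F \<Longrightarrow> g i \<in> J"
  shows "(\<Sum>i\<in>F. g i) \<in> J"
  using assms(2)
  by (induction F rule: infinite_finite_induct) (auto intro: poly_ideal_closed[OF assms(1)])

lemma xpow_add: "xpow (\<mu> + \<nu>) = xpow \<mu> * xpow \<nu>"
  by (simp add: xpow_def mult_single)

lemma xpow_zero [simp]: "xpow 0 = 1"
  by (simp add: xpow_def)

lemma keys_xpow [simp]: "keys (xpow \<mu> :: 'k::field mpol) = {\<mu>}"
  by (simp add: xpow_def)

lemma xpow_mem_mon_span [simp]: "xpow \<mu> \<in> mon_span S \<longleftrightarrow> \<mu> \<in> S"
  by (simp add: mon_span_def)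

lemma mon_span_mono: "S \<subseteq> T \<Longrightarrow> mon_span S \<subseteq> mon_span T"
  by (auto simp: mon_span_def)

lemma ideal_mon_span:
  assumes "upset n S"
  shows "ideal (mon_span S) (poly_ring n)"
  unfolding poly_ideal_iff carrier_poly_ring
proof (intro conjI ballI)
  show "mon_span S \<subseteq> mon_span (expos n)" using assms by (auto simp: upset_def mon_span_def)
  fix p q :: "'a mpol" assume "p \<in> mon_span S" "q \<in> mon_span S"
  then show "p + q \<in> mon_span S" using Poly_Mapping.keys_add[of p q] by (auto simp: mon_span_def)
next
  fix r p :: "'a mpol" assume rp: "r \<in> mon_span (expos n)" "p \<in> mon_span S"
  have "\<mu> \<in> S" if \<mu>: "\<mu> \<in> keys (r * p)" for \<mu>
  proof -
    obtain \<kappa> \<nu> where "\<mu> = \<kappa> + \<nu>" "\<kappa> \<in> keys r" "\<nu> \<in> keys p"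
      using \<mu> Poly_Mapping.keys_mult[of r p] by blast
    moreover from this have "\<nu> \<in> S" "\<kappa> \<in> expos n" using rp by (auto simp: mon_span_def)
    then have "\<nu> + \<kappa> \<in> S" using assms by (simp add: upset_def)
    ultimately show ?thesis by (simp add: add.commute)
  qed
  then show "r * p \<in> mon_span S" by (auto simp: mon_span_def)
qed (simp add: mon_span_def)

lemma poly_mapping_eq_sum_single: "p = (\<Sum>\<mu>\<in>keys p. single \<mu> (lookup p \<mu>))"
  by (rule poly_mapping_eqI) (simp add: lookup_sum lookup_single when_def in_keys_iff)

lemma mon_span_subset:
  fixes J :: "'k::field mpol set"
  assumes J: "ideal J (poly_ring n)" and S: "xpow ` S \<subseteq> J"
  shows "mon_span S \<subseteq> J"
proof
  fix p :: "'k mpol" assume "p \<in> mon_span S"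
  have "single \<mu> (lookup p \<mu>) \<in> J" if "\<mu> \<in> keys p" for \<mu>
  proof -
    have "single \<mu> (lookup p \<mu>) = single 0 (lookup p \<mu>) * xpow \<mu>"
      by (simp add: xpow_def mult_single)
    moreover have "xpow \<mu> \<in> J" using that \<open>p \<in> mon_span S\<close> S by (auto simp: mon_span_def)
    moreover have "single 0 (lookup p \<mu>) \<in> carrier (poly_ring n)"
      by (simp add: carrier_poly_ring mon_span_def)
    ultimately show ?thesis using poly_ideal_closed(4)[OF J] by metis
  qed
  then have "(\<Sum>\<mu>\<in>keys p. single \<mu> (lookup p \<mu>)) \<in> J" by (rule poly_ideal_sum[OF J])
  then show "p \<in> J" by (simp flip: poly_mapping_eq_sum_single)
qed

lemma Idl_poly_ring:
  fixes S :: "'k::field mpol set"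
  assumes "S \<subseteq> carrier (poly_ring n)"
  shows "ideal (Idl\<^bsub>poly_ring n\<^esub> S) (poly_ring n)" "S \<subseteq> Idl\<^bsub>poly_ring n\<^esub> S"
    "ideal J (poly_ring n) \<Longrightarrow> S \<subseteq> J \<Longrightarrow> Idl\<^bsub>poly_ring n\<^esub> S \<subseteq> J"
proof -
  interpret R: cring "poly_ring n :: 'k mpol ring" by (rule cring_poly_ring)
  show "ideal (Idl\<^bsub>poly_ring n\<^esub> S) (poly_ring n)" by (rule R.genideal_ideal[OF assms])
  show "S \<subseteq> Idl\<^bsub>poly_ring n\<^esub> S" by (rule R.genideal_self[OF assms])
  show "ideal J (poly_ring n) \<Longrightarrow> S \<subseteq> J \<Longrightarrow> Idl\<^bsub>poly_ring n\<^esub> S \<subseteq> J"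
    by (rule R.genideal_minimal)
qed

lemma Idl_xpow_upset:
  fixes S :: "expo set"
  assumes "upset n S"
  shows "Idl\<^bsub>poly_ring n\<^esub> (xpow ` S) = (mon_span S :: 'k::field mpol set)"
proof -
  have c: "xpow ` S \<subseteq> (carrier (poly_ring n) :: 'k mpol set)"
    using assms by (auto simp: carrier_poly_ring upset_def)
  show ?thesis
    by (intro subset_antisym Idl_poly_ring(3)[OF c] mon_span_subset[OF Idl_poly_ring(1)[OF c]]
        ideal_mon_span[OF assms] Idl_poly_ring(2)[OF c]) auto
qed

lemma Idl_xvar:
  assumes "A \<subseteq> {1..n}"
  shows "Idl\<^bsub>poly_ring n\<^esub> (xvar ` A) = (mon_span (weight_ge n A 1) :: 'k::field mpol set)"
proof (rule subset_antisym)
  have fin: "finite A" using assms finite_subset by blast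
  have c: "xvar ` A \<subseteq> (carrier (poly_ring n) :: 'k mpol set)"
    using assms expos_single by (auto simp: carrier_poly_ring xvar_def)
  note Idl = Idl_poly_ring[OF c]
  show "Idl\<^bsub>poly_ring n\<^esub> (xvar ` A) \<subseteq> (mon_span (weight_ge n A 1) :: 'k mpol set)"
  proof (rule Idl(3)[OF ideal_mon_span[OF upset_weight_ge]], rule image_subsetI)
    fix i assume "i \<in> A"
    then have "single i 1 \<in> weight_ge n A 1"
      using assms fin expos_single[of i n 1] by (auto simp: weight_ge_def weight_single)
    then show "xvar i \<in> (mon_span (weight_ge n A 1) :: 'k mpol set)" by (simp add: xvar_def)
  qed
  have "xpow \<mu> \<in> Idl\<^bsub>poly_ring n\<^esub> (xvar ` A :: 'k mpol set)" if \<mu>: "\<mu> \<in> weight_ge n A 1" for \<mu>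
  proof -
    have "weight A \<mu> \<noteq> 0" using \<mu> by (simp add: weight_ge_def)
    then obtain i where i: "i \<in> A" "lookup \<mu> i \<noteq> 0"
      unfolding weight_def by (meson sum.neutral)
    have eq: "\<mu> = (\<mu> - single i 1) + single i 1"
      using i by (intro poly_mapping_eqI) (auto simp: lookup_add lookup_minus lookup_single when_def)
    have "\<mu> - single i 1 \<in> expos n"
      using \<mu> by (auto simp: weight_ge_def expos_def in_keys_iff lookup_minus subset_iff)
    then have "xpow (\<mu> - single i 1) \<in> (carrier (poly_ring n) :: 'k mpol set)" by (simp add: carrier_poly_ring)
    moreover have "xvar i \<in> Idl\<^bsub>poly_ring n\<^esub> (xvar ` A :: 'k mpol set)" using Idl(2) i by auto
    ultimately have "xpow (\<mu> - single i 1) * xvar i \<in> Idl\<^bsub>poly_ring n\<^esub> (xvar ` A :: 'k mpol set)"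
      using poly_ideal_closed(4)[OF Idl(1)] by blast
    then show ?thesis using eq by (metis xpow_add xvar_def)
  qed
  then show "mon_span (weight_ge n A 1) \<subseteq> (Idl\<^bsub>poly_ring n\<^esub> (xvar ` A) :: 'k mpol set)"
    by (intro mon_span_subset[OF Idl(1)]) auto
qed

section \<open>Permutations of the variables acting on monomial ideals\<close>

lemma lookup_permute_vars:
  assumes "\<sigma> permutes {1..n}"
  shows "lookup (permute_vars \<sigma> p) \<mu> = lookup p (permute_expo \<sigma> \<mu>)"
  unfolding permute_vars_def by (simp add: map_key.rep_eq permute_expo_inj[OF assms])

lemma permute_vars_inverse:
  assumes "\<sigma> permutes {1..n}"
  shows "permute_vars \<sigma> (permute_vars (inv_into UNIV \<sigma>) p) = p"
  by (rule poly_mapping_eqI) (simp add: lookup_permute_vars[OF assms]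
      lookup_permute_vars[OF permutes_inv[OF assms]] permute_expo_inverse[OF assms])

text \<open>\<open>permute_expo\<close> composes an exponent with \<sigma>, whereas x_i is sent to
  x_(\<sigma> i), so exponents move by the inverse permutation.\<close>

lemma permute_vars_xpow:
  assumes "\<sigma> permutes {1..n}"
  shows "permute_vars (inv_into UNIV \<sigma>) (xpow \<mu>) = xpow (permute_expo \<sigma> \<mu>)"
proof -
  have *: "\<mu> = permute_expo (inv_into UNIV \<sigma>) \<kappa> \<longleftrightarrow> permute_expo \<sigma> \<mu> = \<kappa>" for \<kappa>
    using permute_expo_inverse[OF assms] by metis
  show ?thesis
    by (rule poly_mapping_eqI) (simp add: lookup_permute_vars[OF permutes_inv[OF assms]] xpow_def lookup_single *)
qed

lemma permute_vars_mon_span: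
  assumes "\<sigma> permutes {1..n}"
  shows "permute_vars \<sigma> ` mon_span S = mon_span {\<mu>. permute_expo \<sigma> \<mu> \<in> S}"
proof (intro subset_antisym subsetI)
  fix q :: "'a mpol" assume "q \<in> permute_vars \<sigma> ` mon_span S"
  then show "q \<in> mon_span {\<mu>. permute_expo \<sigma> \<mu> \<in> S}"
    by (auto simp: mon_span_def in_keys_iff lookup_permute_vars[OF assms] subset_iff)
next
  fix q :: "'a mpol" assume q: "q \<in> mon_span {\<mu>. permute_expo \<sigma> \<mu> \<in> S}"
  have "permute_vars (inv_into UNIV \<sigma>) q \<in> mon_span S"
    using q by (auto simp: mon_span_def in_keys_iff lookup_permute_vars[OF permutes_inv[OF assms]] subset_iff)
      (metis permute_expo_inverse(2)[OF assms])
  then show "q \<in> permute_vars \<sigma> ` mon_span S"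
    using permute_vars_inverse[OF assms, of q] by force
qed

lemma permute_vars_vars_ideal:
  assumes "\<sigma> permutes {1..n}" "j \<le> n"
  shows "permute_vars \<sigma> ` vars_ideal n j = mon_span (weight_ge n (\<sigma> ` {1..j}) 1)"
proof -
  have "{\<mu>. permute_expo \<sigma> \<mu> \<in> weight_ge n {1..j} 1} = weight_ge n (\<sigma> ` {1..j}) 1"
    by (auto simp: weight_ge_def permute_expo_expos[OF assms(1)] weight_permute_expo[OF assms(1)])
  then show ?thesis
    unfolding vars_ideal_def by (subst Idl_xvar) (use assms(2) in \<open>auto simp: permute_vars_mon_span[OF assms(1)]\<close>)
qed

lemma ideal_prod_mon_span:
  assumes "upset n S" "upset n T"
  shows "ideal_prod (poly_ring n) (mon_span S) (mon_span T) = (mon_span {\<alpha> + \<beta> | \<alpha> \<beta>. \<alpha> \<in> S \<and> \<beta> \<in> T} :: 'k::field mpol set)"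
    (is "?l = mon_span ?U")
proof (rule subset_antisym)
  interpret R: cring "poly_ring n :: 'k mpol ring" by (rule cring_poly_ring)
  show "?l \<subseteq> mon_span ?U"
  proof
    fix p assume "p \<in> ?l"
    then show "p \<in> mon_span ?U"
    proof induction
      case (prod p q)
      show ?case using prod Poly_Mapping.keys_mult[of p q] by (fastforce simp: mon_span_def)
    next
      case (sum p q)
      then show ?case using Poly_Mapping.keys_add[of p q] by (auto simp: mon_span_def)
    qed
  qed
  have "xpow \<mu> \<in> ?l" if \<mu>: "\<mu> \<in> ?U" for \<mu>
  proof -
    obtain \<alpha> \<beta> where "\<mu> = \<alpha> + \<beta>" "\<alpha> \<in> S" "\<beta> \<in> T" using \<mu> by auto
    then show ?thesis
      using ideal_prod.prod[of "xpow \<alpha>" "mon_span S" "xpow \<beta>" "mon_span T" "poly_ring n"]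
      by (simp add: xpow_add)
  qed
  then show "mon_span ?U \<subseteq> ?l"
    by (intro mon_span_subset[where n = n] R.ideal_prod_is_ideal ideal_mon_span assms) auto
qed

section \<open>Principal symmetric strongly shifted ideals and their powers\<close>

text \<open>The span is itself symmetric strongly shifted, by
  \<open>contrapolymatroid_shift\<close>. Conversely the exponents of the monomials in any competing
  J are closed under the three moves, so they contain the contrapolymatroid.\<close>

lemma Sss_eq_mon_span:
  assumes lam: "lam \<in> partitions n"
  shows "Sss n {lam} = (mon_span (contrapolymatroid n (prefix_sum (lookup lam))) :: 'k::field mpol set)"
    (is "_ = mon_span ?E")
proof (rule subset_antisym)
  have up: "upset n ?E" by (rule upset_contrapolymatroid)
  have "symmetric_strongly_shifted n (mon_span ?E :: 'k mpol set)"
    unfolding symmetric_strongly_shifted_def symmetric_monomial_ideal_def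
  proof (intro conjI ballI allI impI)
    show "monomial_ideal n (mon_span ?E :: 'k mpol set)"
      unfolding monomial_ideal_def using Idl_xpow_upset[OF up, symmetric]
      by (intro exI[of _ ?E]) (auto simp: contrapolymatroid_def expos_def)
    fix \<sigma> assume \<sigma>: "\<sigma> permutes {1..n}"
    show "permute_vars \<sigma> ` mon_span ?E = (mon_span ?E :: 'k mpol set)"
      by (simp add: permute_vars_mon_span[OF \<sigma>] permute_expo_contrapolymatroid[OF \<sigma>])
  next
    fix \<mu> i j assume "\<mu> \<in> partitions_of n (mon_span ?E :: 'k mpol set)"
      and "1 \<le> i \<and> i < j \<and> j \<le> n \<and> lookup \<mu> i < lookup \<mu> j"
    then show "xpow (\<mu> + single i 1 - single j 1) \<in> (mon_span ?E :: 'k mpol set)"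
      using contrapolymatroid_shift[of \<mu> n _ i j] by (auto simp: partitions_of_def)
  qed
  moreover have "xpow ` {lam} \<subseteq> (mon_span ?E :: 'k mpol set)"
    using partition_mem_contrapolymatroid[OF lam] by simp
  ultimately show "Sss n {lam} \<subseteq> (mon_span ?E :: 'k mpol set)" unfolding Sss_def by blast
  show "mon_span ?E \<subseteq> (Sss n {lam} :: 'k mpol set)"
    unfolding Sss_def
  proof (rule Inter_greatest, clarify)
    fix J :: "'k mpol set" and p :: "'k mpol"
    assume J: "symmetric_strongly_shifted n J" and lamJ: "xpow ` {lam} \<subseteq> J" and p: "p \<in> mon_span ?E"
    from J have "monomial_ideal n J" by (simp add: symmetric_strongly_shifted_def symmetric_monomial_ideal_def)
    then obtain M where M: "\<forall>\<mu>\<in>M. keys \<mu> \<subseteq> {1..n}" "J = Idl\<^bsub>poly_ring n\<^esub> (xpow ` M)"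
      unfolding monomial_ideal_def by blast
    then have "xpow ` M \<subseteq> (carrier (poly_ring n) :: 'k mpol set)" by (auto simp: carrier_poly_ring expos_def)
    from Idl_poly_ring(1)[OF this] have ideal: "ideal J (poly_ring n)" using M by simp
    have "?E \<subseteq> {\<mu>. xpow \<mu> \<in> J}"
    proof (rule contrapolymatroid_subset_shift_closed[OF lam])
      show "lam \<in> {\<mu>. xpow \<mu> \<in> J}" using lamJ by simp
      fix \<mu> i assume \<mu>: "\<mu> \<in> {\<mu>. xpow \<mu> \<in> J}"
      show "\<mu> + single i 1 \<in> {\<mu>. xpow \<mu> \<in> J}" if "i \<in> {1..n}"
        using poly_ideal_closed(4)[OF ideal, of "xpow (single i 1)" "xpow \<mu>"] \<mu> that expos_single[OF that]
        by (simp add: carrier_poly_ring flip: xpow_add) (simp add: add.commute)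
      show "\<mu> + single i 1 - single j 1 \<in> {\<mu>. xpow \<mu> \<in> J}"
        if "\<mu> \<in> partitions n" "1 \<le> i" "i < j" "j \<le> n" "lookup \<mu> i < lookup \<mu> j" for j
        using J \<mu> that unfolding symmetric_strongly_shifted_def partitions_of_def by auto
    next
      fix \<sigma> \<mu> assume \<sigma>: "\<sigma> permutes {1..n}" and \<mu>: "\<mu> \<in> {\<mu>. xpow \<mu> \<in> J}"
      have "permute_vars (inv_into UNIV \<sigma>) ` J = J"
        using J permutes_inv[OF \<sigma>] by (simp add: symmetric_strongly_shifted_def symmetric_monomial_ideal_def)
      then show "permute_expo \<sigma> \<mu> \<in> {\<mu>. xpow \<mu> \<in> J}"
        using \<mu> permute_vars_xpow[OF \<sigma>, of \<mu>] by (metis imageI mem_Collect_eq)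
    qed
    then show "p \<in> J" using mon_span_subset[OF ideal, of ?E] p by blast
  qed
qed

text \<open>Multiplying monomial ideals adds exponent sets, and by
  \<open>contrapolymatroid_split\<close> the sums fill everything that the added bounds
  allow.\<close>

lemma ideal_power_Sss:
  assumes lam: "lam \<in> partitions n"
  shows "ideal_power (poly_ring n) (Sss n {lam}) k =
    (mon_span (contrapolymatroid n (\<lambda>m. k * prefix_sum (lookup lam) m)) :: 'k::field mpol set)"
proof (induction k)
  case 0
  show ?case
    by (simp add: ideal_power_def nat_pow_def ideals_set_def carrier_poly_ring contrapolymatroid_def)
next
  case (Suc k)
  let ?f = "prefix_sum (lookup lam)"
  let ?E = "\<lambda>k. contrapolymatroid n (\<lambda>m. k * ?f m)"
  have "ideal_power (poly_ring n) (Sss n {lam} :: 'k mpol set) (Suc k) =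
    ideal_prod (poly_ring n) (ideal_power (poly_ring n) (Sss n {lam}) k) (Sss n {lam})"
    by (simp add: ideal_power_def nat_pow_def ideals_set_def)
  also have "\<dots> = ideal_prod (poly_ring n) (mon_span (?E k)) (mon_span (contrapolymatroid n ?f))"
    unfolding Suc.IH unfolding Sss_eq_mon_span[OF lam] ..
  also have "\<dots> = mon_span {\<alpha> + \<beta> | \<alpha> \<beta>. \<alpha> \<in> ?E k \<and> \<beta> \<in> contrapolymatroid n ?f}"
    by (intro ideal_prod_mon_span upset_contrapolymatroid)
  also have "{\<alpha> + \<beta> | \<alpha> \<beta>. \<alpha> \<in> ?E k \<and> \<beta> \<in> contrapolymatroid n ?f} = ?E (Suc k)"
  proof (intro subset_antisym subsetI)
    fix \<mu> assume "\<mu> \<in> {\<alpha> + \<beta> | \<alpha> \<beta>. \<alpha> \<in> ?E k \<and> \<beta> \<in> contrapolymatroid n ?f}"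
    then show "\<mu> \<in> ?E (Suc k)"
      using contrapolymatroid_add_add[of _ n "\<lambda>m. k * ?f m" _ ?f] by (auto simp: add.commute)
  next
    fix \<mu> assume "\<mu> \<in> ?E (Suc k)"
    then show "\<mu> \<in> {\<alpha> + \<beta> | \<alpha> \<beta>. \<alpha> \<in> ?E k \<and> \<beta> \<in> contrapolymatroid n ?f}"
      using contrapolymatroid_split[OF lam] by blast
  qed
  finally show ?case .
qed

section \<open>Associated primes\<close>

lemma split_by_keys:
  fixes p :: "'k::field mpol"
  obtains q r where "p = q + r" "keys q = {\<mu> \<in> keys p. S \<mu>}" "keys r = {\<mu> \<in> keys p. \<not> S \<mu>}"
proof -
  define q where "q = Abs_poly_mapping (\<lambda>\<mu>. if S \<mu> then lookup p \<mu> else 0)"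
  have q: "lookup q = (\<lambda>\<mu>. if S \<mu> then lookup p \<mu> else 0)"
    unfolding q_def by (rule lookup_Abs_poly_mapping) (rule finite_subset[of _ "keys p"], auto simp: in_keys_iff)
  show thesis
    by (rule that[of q "p - q"]) (auto simp: in_keys_iff lookup_minus q split: if_splits)
qed

text \<open>Compare the components of lowest \<open>A\<close>-degree, whose product does not vanish.\<close>

lemma mem_weight_ge_cancel:
  fixes p s :: "'k::field mpol"
  assumes s: "s \<in> carrier (poly_ring n)" "s \<notin> mon_span (weight_ge n A 1)"
    and p: "p \<in> carrier (poly_ring n)" and sp: "s * p \<in> mon_span (weight_ge n A t)"
  shows "p \<in> mon_span (weight_ge n A t)"
proof (rule ccontr)
  assume "p \<notin> mon_span (weight_ge n A t)"
  then obtain \<mu> where \<mu>: "\<mu> \<in> keys p" "weight A \<mu> < t"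
    using p by (auto simp: mon_span_def weight_ge_def carrier_poly_ring subset_iff)
  define d where "d = Min (weight A ` keys p)"
  have "d \<in> weight A ` keys p" unfolding d_def using \<mu> by (intro Min_in) auto
  then obtain \<nu> where \<nu>: "\<nu> \<in> keys p" "weight A \<nu> = d" by auto
  have d_le: "d \<le> weight A \<kappa>" if "\<kappa> \<in> keys p" for \<kappa> unfolding d_def using that by (intro Min_le) auto
  then have "d < t" using \<mu> by fastforce
  obtain \<xi> where \<xi>: "\<xi> \<in> keys s" "\<xi> \<notin> weight_ge n A 1"
    using s(2) unfolding mon_span_def by blast
  moreover from this have "\<xi> \<in> expos n" using s(1) by (auto simp: carrier_poly_ring mon_span_def)
  ultimately have w\<xi>: "weight A \<xi> = 0" by (simp add: weight_ge_def)
  obtain p1 p2 where p12: "p = p1 + p2" "keys p1 = {\<mu> \<in> keys p. weight A \<mu> = d}"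
    "keys p2 = {\<mu> \<in> keys p. weight A \<mu> \<noteq> d}" by (rule split_by_keys)
  obtain s1 s2 where s12: "s = s1 + s2" "keys s1 = {\<mu> \<in> keys s. weight A \<mu> = 0}"
    "keys s2 = {\<mu> \<in> keys s. weight A \<mu> \<noteq> 0}" by (rule split_by_keys)
  \<comment> \<open>s1 is nonzero because s, lying outside the prime of A, has a term of A-degree
    0.\<close>
  have "p1 \<noteq> 0" "s1 \<noteq> 0" using p12(2) s12(2) \<nu> \<xi>(1) w\<xi> by auto
  then have "s1 * p1 \<noteq> 0" by simp
  then obtain \<kappa> where \<kappa>: "\<kappa> \<in> keys (s1 * p1)" using keys_eq_empty by blast
  obtain a b where ab: "\<kappa> = a + b" "a \<in> keys s1" "b \<in> keys p1"
    using \<kappa> Poly_Mapping.keys_mult[of s1 p1] by blast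
  then have wk: "weight A \<kappa> = d" using p12 s12 by (auto simp: weight_add)
  \<comment> \<open>The remaining products only have terms of A-degree different from d, so they
    cannot cancel the term at \<kappa>.\<close>
  have "\<kappa> \<notin> keys (s1 * p2)"
  proof
    assume "\<kappa> \<in> keys (s1 * p2)"
    then obtain a b where "\<kappa> = a + b" "a \<in> keys s1" "b \<in> keys p2"
      using Poly_Mapping.keys_mult[of s1 p2] by blast
    then show False using wk p12 s12 by (auto simp: weight_add)
  qed
  moreover have "\<kappa> \<notin> keys (s2 * p)"
  proof
    assume "\<kappa> \<in> keys (s2 * p)"
    then obtain a b where "\<kappa> = a + b" "a \<in> keys s2" "b \<in> keys p"
      using Poly_Mapping.keys_mult[of s2 p] by blast
    then show False using wk s12 d_le[of b] by (auto simp: weight_add)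
  qed
  moreover have "s * p = s1 * p1 + s1 * p2 + s2 * p"
    unfolding s12(1) p12(1) by (simp add: algebra_simps)
  ultimately have "lookup (s * p) \<kappa> = lookup (s1 * p1) \<kappa>"
    by (simp add: lookup_add in_keys_iff)
  then have "\<kappa> \<in> keys (s * p)" using \<kappa> by (simp add: in_keys_iff)
  then have "t \<le> weight A \<kappa>" using sp by (auto simp: mon_span_def weight_ge_def)
  then show False using wk \<open>d < t\<close> by simp
qed

lemma ideal_weight_ge: "ideal (mon_span (weight_ge n A t)) (poly_ring n)"
  by (rule ideal_mon_span[OF upset_weight_ge])

lemma one_notin_weight_ge: "1 \<notin> (mon_span (weight_ge n A 1) :: 'k::field mpol set)"
  by (simp add: mon_span_def weight_ge_def weight_def)

lemma primeideal_weight_ge: "primeideal (mon_span (weight_ge n A 1) :: 'k::field mpol set) (poly_ring n)"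
proof (rule primeidealI[OF ideal_weight_ge cring_poly_ring])
  show "carrier (poly_ring n) \<noteq> (mon_span (weight_ge n A 1) :: 'k mpol set)"
    using one_notin_weight_ge carrier_poly_ring_closed(2) by blast
  fix a b :: "'k mpol"
  assume "a \<in> carrier (poly_ring n)" "b \<in> carrier (poly_ring n)"
    "a \<otimes>\<^bsub>poly_ring n\<^esub> b \<in> mon_span (weight_ge n A 1)"
  then show "a \<in> mon_span (weight_ge n A 1) \<or> b \<in> mon_span (weight_ge n A 1)"
    using mem_weight_ge_cancel[of a n A b 1] by auto
qed

text \<open>The decomposition into primary ideals, stated as a finite family in the form required by
  \<open>prime_eq_colon\<close>.\<close>

lemma mem_mon_span_contrapolymatroid_iff:
  "p \<in> mon_span (contrapolymatroid n t) \<longleftrightarrow> (\<forall>A\<in>Pow {1..n}. p \<in> mon_span (weight_ge n A (t (card A))))"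
proof
  assume r: "\<forall>A\<in>Pow {1..n}. p \<in> mon_span (weight_ge n A (t (card A)))"
  \<comment> \<open>The component of the empty set provides that the exponents lie in
    \<open>expos n\<close>.\<close>
  have "keys p \<subseteq> weight_ge n {} (t (card {}))" using r[rule_format, of "{}"] unfolding mon_span_def by simp
  moreover have "t (card A) \<le> weight A \<mu>" if "A \<subseteq> {1..n}" "\<mu> \<in> keys p" for A \<mu>
    using r[rule_format, of A] that by (auto simp: mon_span_def weight_ge_def)
  ultimately show "p \<in> mon_span (contrapolymatroid n t)"
    by (auto simp: mon_span_def contrapolymatroid_def weight_ge_def)
qed (auto simp: mon_span_def contrapolymatroid_def weight_ge_def subset_iff)

lemma keys_xpow_mult: "keys (xpow \<mu> * p) = (+) \<mu> ` keys (p :: 'k::field mpol)"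
proof
  show "keys (xpow \<mu> * p) \<subseteq> (+) \<mu> ` keys p"
    using Poly_Mapping.keys_mult[of "xpow \<mu>" p] by auto
  have "xpow \<mu> * p = (\<Sum>\<kappa>\<in>keys p. single (\<mu> + \<kappa>) (lookup p \<kappa>))"
    by (subst (1) poly_mapping_eq_sum_single[of p]) (simp add: sum_distrib_left xpow_def mult_single)
  then have "lookup (xpow \<mu> * p) (\<mu> + \<kappa>) = lookup p \<kappa>" for \<kappa>
    by (simp add: lookup_sum lookup_single when_def in_keys_iff)
  then show "(+) \<mu> ` keys p \<subseteq> keys (xpow \<mu> * p)"
    by (auto simp: in_keys_iff)
qed

lemma xpow_single_power: "xpow (single i k) = (xvar i :: 'k::field mpol) ^ k"
proof (induction k)
  case (Suc k)
  have "single i (Suc k) = single i 1 + single i k" by (simp only: plus_1_eq_Suc single_add[symmetric])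
  then show ?case using Suc by (simp add: xpow_add xvar_def)
qed simp

text \<open>g is the part on A of the exponent of a monomial whose annihilator is the prime of A:
  every proper subset of A is satisfied, and one more unit anywhere in A repairs A itself. Indices
  outside A can be given large entries and impose nothing.\<close>

definition deficit_one :: "(nat \<Rightarrow> nat) \<Rightarrow> nat set \<Rightarrow> bool" where
  "deficit_one t A \<longleftrightarrow> (\<exists>g::nat \<Rightarrow> nat. (\<Sum>i\<in>A. g i) + 1 = t (card A) \<and> (\<forall>B. B \<subset> A \<longrightarrow> t (card B) \<le> (\<Sum>i\<in>B. g i)))"

lemma le_sum_atMost: "m \<le> n \<Longrightarrow> t m \<le> (\<Sum>m\<le>n. t m)" for t :: "nat \<Rightarrow> nat"
  by (rule member_le_sum) auto

lemma lookup_le_weight: "finite B \<Longrightarrow> i \<in> B \<Longrightarrow> lookup \<mu> i \<le> weight B \<mu>"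
  unfolding weight_def by (rule member_le_sum) auto

text \<open>A primary ideal has only its radical as associated prime. Elements of P lie in the
  radical by cancelling y; conversely x_i^t y is in the ideal for i in A, so x_i is in P by
  primality.\<close>

lemma prime_colon_weight_ge:
  fixes P :: "'k::field mpol set"
  assumes A: "A \<subseteq> {1..n}" and P: "primeideal P (poly_ring n)" and y: "y \<in> carrier (poly_ring n)"
    and eq: "P = {f \<in> carrier (poly_ring n). f * y \<in> mon_span (weight_ge n A t)}"
  shows "P = mon_span (weight_ge n A 1)"
proof (rule subset_antisym)
  have P_ideal: "ideal P (poly_ring n)" using P by (rule primeideal.axioms(1))
  have one: "1 \<notin> P"
    using ideal.one_imp_carrier[OF P_ideal] primeideal.I_notcarr[OF P] by auto
  then have "y \<notin> mon_span (weight_ge n A t)"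
    using eq carrier_poly_ring_closed(2) by auto
  then show "P \<subseteq> mon_span (weight_ge n A 1)"
    using mem_weight_ge_cancel[OF _ _ y] eq by blast
  have fin: "finite A" using A finite_subset by blast
  have "xvar i \<in> P" if i: "i \<in> A" for i
  proof -
    have xi: "xvar i \<in> (carrier (poly_ring n) :: 'k mpol set)"
      using i A expos_single[of i n 1] by (auto simp: xvar_def carrier_poly_ring)
    have "single i t \<in> weight_ge n A t"
      using i A fin expos_single[of i n t] by (auto simp: weight_ge_def weight_single)
    then have "xpow (single i t) \<in> (mon_span (weight_ge n A t) :: 'k mpol set)" by simp
    then have "xvar i ^ t \<in> (mon_span (weight_ge n A t) :: 'k mpol set)"
      by (simp only: xpow_single_power)
    then have "y * xvar i ^ t \<in> mon_span (weight_ge n A t)"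
      by (rule poly_ideal_closed(4)[OF ideal_weight_ge y])
    then have "xvar i ^ t \<in> P"
      using eq carrier_poly_ring_closed(7)[OF xi] by (simp add: mult.commute)
    then show ?thesis
    proof (induction t)
      case (Suc t)
      then show ?case
        using primeideal.I_prime[OF P xi carrier_poly_ring_closed(7)[OF xi], of t] by auto
    qed (use one in simp)
  qed
  then have "Idl\<^bsub>poly_ring n\<^esub> (xvar ` A) \<subseteq> P"
    using A expos_single[of _ n 1]
    by (intro Idl_poly_ring(3)[OF _ P_ideal]) (auto simp: xvar_def carrier_poly_ring)
  then show "mon_span (weight_ge n A 1) \<subseteq> P" by (simp add: Idl_xvar[OF A])
qed

text \<open>From a prime J : y the inequality data is read off a single term \<kappa> of y. In the
  other direction a monomial y is built from g, and its colon ideal is computed on supports.\<close>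

lemma Ass_contrapolymatroid:
  assumes t0: "t 0 = 0"
  shows "Ass (poly_ring n) (mon_span (contrapolymatroid n t) :: 'k::field mpol set) =
    {mon_span (weight_ge n A 1) | A. A \<subseteq> {1..n} \<and> deficit_one t A}"
proof -
  let ?J = "mon_span (contrapolymatroid n t) :: 'k mpol set"
  interpret R: cring "poly_ring n :: 'k mpol ring" by (rule cring_poly_ring)
  have J: "ideal ?J (poly_ring n)" by (rule ideal_mon_span[OF upset_contrapolymatroid])
  \<comment> \<open>A common upper bound for all t (card B): one entry N already satisfies every set
    that contains its index.\<close>
  define N where "N = (\<Sum>m\<le>n. t m)"
  have N: "t (card B) \<le> N" if "B \<subseteq> {1..n}" for B
  proof -
    have "card B \<le> n" using card_mono[OF _ that] by simp
    then show ?thesis unfolding N_def by (rule le_sum_atMost)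
  qed
  show ?thesis
  proof (intro subset_antisym subsetI)
    fix P assume "P \<in> Ass (poly_ring n) ?J"
    then obtain y where P: "primeideal P (poly_ring n)" and y: "y \<in> carrier (poly_ring n)"
      and eq: "P = {f \<in> carrier (poly_ring n). f * y \<in> ?J}"
      unfolding R.Ass_iff[OF J] by auto
    have "P = {f \<in> carrier (poly_ring n). \<forall>A\<in>Pow {1..n}. f \<otimes>\<^bsub>poly_ring n\<^esub> y \<in> mon_span (weight_ge n A (t (card A)))}"
      unfolding eq mem_mon_span_contrapolymatroid_iff by simp
    from R.prime_eq_colon[OF P _ ideal_weight_ge y this] obtain A where A: "A \<subseteq> {1..n}"
      and PA: "P = {f \<in> carrier (poly_ring n). f * y \<in> mon_span (weight_ge n A (t (card A)))}"
      by auto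
    have P_eq: "P = mon_span (weight_ge n A 1)"
      by (rule prime_colon_weight_ge[OF A P y PA])
    have fin: "finite B" if "B \<subseteq> {1..n}" for B using that finite_subset by blast
    \<comment> \<open>Entries N outside A act like inverting those variables: x^\<xi> avoids P, and
      a set not contained in A can no longer be violated.\<close>
    obtain \<xi> where \<xi>: "\<xi> \<in> expos n" "\<And>i. i \<in> {1..n} \<Longrightarrow> lookup \<xi> i = (if i \<in> A then 0 else N)"
      by (rule expo_of_fun[of n "\<lambda>i. if i \<in> A then 0 else N"]) blast
    have w\<xi>: "weight B \<xi> = 0" if "B \<subseteq> A" for B
      unfolding weight_def using \<xi>(2)[OF subsetD[OF A]] that by (intro sum.neutral) auto
    have "xpow \<xi> \<notin> P" unfolding P_eq by (simp add: weight_ge_def w\<xi>)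
    then have "xpow \<xi> * y \<notin> ?J" using \<xi>(1) eq by (auto simp: carrier_poly_ring)
    then obtain \<kappa> where \<kappa>: "\<kappa> \<in> keys y" "\<xi> + \<kappa> \<notin> contrapolymatroid n t"
      by (auto simp: mon_span_def keys_xpow_mult)
    have "\<kappa> \<in> expos n" using \<kappa>(1) y by (auto simp: carrier_poly_ring mon_span_def)
    then obtain B where B: "B \<subseteq> {1..n}" "weight B (\<xi> + \<kappa>) < t (card B)"
      using \<kappa>(2) \<xi>(1) by (auto simp: contrapolymatroid_def expos_add not_le)
    have "B \<subseteq> A"
    proof
      fix i assume i: "i \<in> B"
      show "i \<in> A"
      proof (rule ccontr)
        assume "i \<notin> A"
        then have "N \<le> weight B \<xi>" using lookup_le_weight[OF fin[OF B(1)] i, of \<xi>] \<xi>(2)[of i] B(1) i by auto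
        then show False using N[OF B(1)] B(2) by (simp add: weight_add)
      qed
    qed
    \<comment> \<open>Each x_i with i in A lies in P, so raising \<kappa> at i repairs every
      violation. Hence a violated subset of A contains all of A, and its deficit is exactly
      one.\<close>
    have w\<kappa>: "t (card C) \<le> weight C \<kappa> + (if i \<in> C then 1 else 0)" if "i \<in> A" "C \<subseteq> A" for i C
    proof -
      have C: "C \<subseteq> {1..n}" using that A by auto
      have "xvar i \<in> P"
        unfolding P_eq using that(1) A fin[OF A] expos_single[of i n 1]
        by (auto simp: xvar_def weight_ge_def weight_single)
      then have "single i 1 + \<kappa> \<in> contrapolymatroid n t"
        using \<kappa>(1) eq by (auto simp: xvar_def mon_span_def keys_xpow_mult)
      from contrapolymatroidD[OF this C] show ?thesis
        using fin[OF C] by (simp add: weight_add weight_single split: if_splits)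
    qed
    have less: "weight B \<kappa> < t (card B)" using B(2) by (simp add: weight_add)
    have "A = B"
    proof
      show "A \<subseteq> B"
      proof
        fix i assume "i \<in> A"
        then show "i \<in> B" using w\<kappa>[OF _ \<open>B \<subseteq> A\<close>, of i] less by (auto split: if_splits)
      qed
    qed fact
    have "A \<noteq> {}" using less t0 \<open>A = B\<close> by auto
    then obtain i where "i \<in> A" by blast
    then have "weight A \<kappa> + 1 = t (card A)" using w\<kappa>[of i A] less \<open>A = B\<close> by simp
    moreover have "t (card C) \<le> weight C \<kappa>" if C: "C \<subset> A" for C
    proof -
      obtain i where "i \<in> A" "i \<notin> C" using C by blast
      then show ?thesis using w\<kappa>[of i C] C by auto
    qed
    ultimately have "deficit_one t A"
      unfolding deficit_one_def weight_def by (intro exI[of _ "lookup \<kappa>"]) blast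
    then show "P \<in> {mon_span (weight_ge n A 1) | A. A \<subseteq> {1..n} \<and> deficit_one t A}"
      using P_eq A by blast
  next
    fix P :: "'k mpol set" assume "P \<in> {mon_span (weight_ge n A 1) | A. A \<subseteq> {1..n} \<and> deficit_one t A}"
    then obtain A g where P: "P = mon_span (weight_ge n A 1)" and A: "A \<subseteq> {1..n}"
      and g: "(\<Sum>i\<in>A. g i) + 1 = t (card A)" "\<And>B. B \<subset> A \<Longrightarrow> t (card B) \<le> (\<Sum>i\<in>B. g i)"
      unfolding deficit_one_def by blast
    \<comment> \<open>The witness monomial: g on A, and outside A entries so large that only subsets
      of A impose a condition.\<close>
    obtain \<mu> where \<mu>: "\<mu> \<in> expos n" "\<And>i. i \<in> {1..n} \<Longrightarrow> lookup \<mu> i = (if i \<in> A then g i else N)"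
      by (rule expo_of_fun[of n "\<lambda>i. if i \<in> A then g i else N"]) blast
    have w: "weight B \<mu> = (\<Sum>i\<in>B. g i)" if "B \<subseteq> A" for B
      unfolding weight_def using \<mu>(2)[OF subsetD[OF A]] that by (intro sum.cong) auto
    have "\<mu> + \<kappa> \<in> contrapolymatroid n t \<longleftrightarrow> \<kappa> \<in> weight_ge n A 1" if \<kappa>: "\<kappa> \<in> expos n" for \<kappa>
    proof
      assume "\<mu> + \<kappa> \<in> contrapolymatroid n t"
      from contrapolymatroidD[OF this A] show "\<kappa> \<in> weight_ge n A 1"
        using w[of A] g(1) \<kappa> by (simp add: weight_add weight_ge_def)
    next
      assume \<kappa>1: "\<kappa> \<in> weight_ge n A 1"
      have "t (card B) \<le> weight B (\<mu> + \<kappa>)" if B: "B \<subseteq> {1..n}" for B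
      proof -
        consider "B = A" | "B \<subset> A" | i where "i \<in> B" "i \<notin> A" by blast
        then show ?thesis
        proof cases
          case 1
          then show ?thesis using w[of A] g(1) \<kappa>1 by (simp add: weight_add weight_ge_def)
        next
          case 2
          then show ?thesis using w[of B] g(2)[of B] by (simp add: weight_add)
        next
          case 3
          have "finite B" using B finite_subset by blast
          then have "N \<le> weight B \<mu>" using lookup_le_weight[of B i \<mu>] \<mu>(2)[of i] B 3 by auto
          then show ?thesis using N[OF B] by (simp add: weight_add)
        qed
      qed
      then show "\<mu> + \<kappa> \<in> contrapolymatroid n t"
        using \<mu>(1) \<kappa> by (simp add: contrapolymatroid_def expos_add)
    qed
    then have "f \<in> P \<longleftrightarrow> f \<otimes>\<^bsub>poly_ring n\<^esub> xpow \<mu> \<in> ?J" if "f \<in> carrier (poly_ring n)" for f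
      using that unfolding P poly_ring_ops mult.commute[of f] carrier_poly_ring mon_span_def
      by (auto simp: subset_iff keys_xpow_mult)
    moreover have "P \<subseteq> carrier (poly_ring n)"
      unfolding P carrier_poly_ring by (rule mon_span_mono) (auto simp: weight_ge_def)
    ultimately have "P = {f \<in> carrier (poly_ring n). f \<otimes>\<^bsub>poly_ring n\<^esub> xpow \<mu> \<in> ?J}" by blast
    moreover have "xpow \<mu> \<in> (carrier (poly_ring n) :: 'k mpol set)"
      using \<mu>(1) by (simp add: carrier_poly_ring)
    moreover have "primeideal P (poly_ring n)" unfolding P by (rule primeideal_weight_ge)
    ultimately show "P \<in> Ass (poly_ring n) ?J"
      unfolding R.Ass_iff[OF J] by blast
  qed
qed

section \<open>Symbolic powers\<close>

lemma local_ring_ops [simp]: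
  "mult (local_ring n P) = (*)" "add (local_ring n P) = (+)" "one (local_ring n P) = 1" "zero (local_ring n P) = 0"
  by (simp_all add: local_ring_def)

lemma mem_local_ring: "x \<in> carrier (local_ring n P) \<longleftrightarrow>
    (\<exists>a s. x = Fract a s \<and> a \<in> carrier (poly_ring n) \<and> s \<in> carrier (poly_ring n) \<and> s \<notin> P)"
  by (auto simp: local_ring_def)

lemma primeideal_poly_ring:
  fixes P :: "'k::field mpol set"
  assumes "primeideal P (poly_ring n)"
  shows "0 \<in> P" "1 \<notin> P"
    "s \<in> carrier (poly_ring n) \<Longrightarrow> s' \<in> carrier (poly_ring n) \<Longrightarrow> s \<notin> P \<Longrightarrow> s' \<notin> P \<Longrightarrow> s * s' \<notin> P"
proof -
  have P: "ideal P (poly_ring n)" using assms by (rule primeideal.axioms(1))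
  show "0 \<in> P" by (rule poly_ideal_closed(1)[OF P])
  show "1 \<notin> P" using ideal.one_imp_carrier[OF P] primeideal.I_notcarr[OF assms] by auto
  show "s \<in> carrier (poly_ring n) \<Longrightarrow> s' \<in> carrier (poly_ring n) \<Longrightarrow> s \<notin> P \<Longrightarrow> s' \<notin> P \<Longrightarrow> s * s' \<notin> P"
    using primeideal.I_prime[OF assms, of s s'] by auto
qed

lemma cring_local_ring:
  fixes P :: "'k::field mpol set"
  assumes P: "primeideal P (poly_ring n)"
  shows "cring (local_ring n P)"
proof -
  note prime = primeideal_poly_ring[OF P] and closed = carrier_poly_ring_closed[where n = n and 'k = 'k]
  have zero: "0 \<in> carrier (local_ring n P)" and one: "1 \<in> carrier (local_ring n P)"
    unfolding mem_local_ring using closed(1,2) prime(2) by (metis Zero_fract_def, metis One_fract_def)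
  have add: "x + y \<in> carrier (local_ring n P)" and mult: "x * y \<in> carrier (local_ring n P)"
    if xy: "x \<in> carrier (local_ring n P)" "y \<in> carrier (local_ring n P)" for x y
  proof -
    obtain a s b r where a: "x = Fract a s" "a \<in> carrier (poly_ring n)" "s \<in> carrier (poly_ring n)" "s \<notin> P"
      and b: "y = Fract b r" "b \<in> carrier (poly_ring n)" "r \<in> carrier (poly_ring n)" "r \<notin> P"
      using xy unfolding mem_local_ring by blast
    have "s \<noteq> 0" "r \<noteq> 0" using a b prime(1) by auto
    then have "x + y = Fract (a * r + b * s) (s * r)" "x * y = Fract (a * b) (s * r)"
      using a b by auto
    moreover have "s * r \<notin> P" "s * r \<in> carrier (poly_ring n)" "a * r + b * s \<in> carrier (poly_ring n)"
      "a * b \<in> carrier (poly_ring n)"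
      using a b prime(3) closed(3,4) by auto
    ultimately show "x + y \<in> carrier (local_ring n P)" "x * y \<in> carrier (local_ring n P)"
      unfolding mem_local_ring by blast+
  qed
  have neg: "- x \<in> carrier (local_ring n P)" if x: "x \<in> carrier (local_ring n P)" for x
  proof -
    obtain a s where "x = Fract a s" "a \<in> carrier (poly_ring n)" "s \<in> carrier (poly_ring n)" "s \<notin> P"
      using x unfolding mem_local_ring by blast
    then have "- x = Fract (- a) s" "- a \<in> carrier (poly_ring n)" using closed(5) by auto
    then show ?thesis unfolding mem_local_ring using \<open>s \<in> _\<close> \<open>s \<notin> P\<close> by blast
  qed
  show ?thesis
  proof (rule cringI)
    show "abelian_group (local_ring n P)"
    proof (rule abelian_groupI, unfold local_ring_ops)
      fix x assume "x \<in> carrier (local_ring n P)"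
      then show "\<exists>y\<in>carrier (local_ring n P). y + x = 0"
        by (intro bexI[of _ "- x"] neg) simp_all
    qed (simp_all add: add zero add.assoc add.commute)
    show "Group.comm_monoid (local_ring n P)"
      by (rule comm_monoidI, unfold local_ring_ops) (simp_all add: mult one mult.assoc mult.commute)
  qed (simp add: distrib_right)
qed

text \<open>The fractions with numerator in Q form an ideal of the local ring that contains the
  image of J. If f/1 = a/s with a in Q, then s f = a, and s can be cancelled. Applied with Q a
  primary component of J and P its radical.\<close>

lemma local_contraction_subset:
  fixes P :: "'k::field mpol set"
  assumes P: "primeideal P (poly_ring n)" and Q: "ideal Q (poly_ring n)" and JQ: "J \<subseteq> Q"
    and cancel: "\<And>s f. s \<in> carrier (poly_ring n) \<Longrightarrow> s \<notin> P \<Longrightarrow> f \<in> carrier (poly_ring n) \<Longrightarrow> s * f \<in> Q \<Longrightarrow> f \<in> Q"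
  shows "local_contraction n P J \<subseteq> Q"
proof
  note prime = primeideal_poly_ring[OF P] and closed = carrier_poly_ring_closed[where n = n and 'k = 'k]
  note Qc = poly_ideal_closed[OF Q]
  define K where "K = {Fract a s | a s. a \<in> Q \<and> s \<in> carrier (poly_ring n) \<and> s \<notin> P}"
  have memK: "x \<in> K \<longleftrightarrow> (\<exists>a s. x = Fract a s \<and> a \<in> Q \<and> s \<in> carrier (poly_ring n) \<and> s \<notin> P)" for x
    by (auto simp: K_def)
  interpret L: cring "local_ring n P" by (rule cring_local_ring[OF P])
  have "ideal K (local_ring n P)"
  proof (rule L.cring_idealI, unfold local_ring_ops)
    show "K \<subseteq> carrier (local_ring n P)" using Qc(2) unfolding subset_iff memK mem_local_ring by blast
    show "0 \<in> K" unfolding memK using Qc(1) closed(2) prime(2) by (metis Zero_fract_def)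
  next
    fix x y assume "x \<in> K" "y \<in> K"
    then obtain a s b r where a: "x = Fract a s" "a \<in> Q" "s \<in> carrier (poly_ring n)" "s \<notin> P"
      and b: "y = Fract b r" "b \<in> Q" "r \<in> carrier (poly_ring n)" "r \<notin> P"
      unfolding memK by blast
    have "s \<noteq> 0" "r \<noteq> 0" using a b prime(1) by auto
    then have "x + y = Fract (r * a + s * b) (s * r)" using a b by (simp add: mult.commute)
    moreover have "s * r \<notin> P" "s * r \<in> carrier (poly_ring n)" "r * a + s * b \<in> Q"
      using a b prime(3) closed(4) Qc(3,4) by auto
    ultimately show "x + y \<in> K" unfolding memK by blast
  next
    fix y x assume "y \<in> carrier (local_ring n P)" "x \<in> K"
    then obtain a s b r where a: "x = Fract a s" "a \<in> Q" "s \<in> carrier (poly_ring n)" "s \<notin> P"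
      and b: "y = Fract b r" "b \<in> carrier (poly_ring n)" "r \<in> carrier (poly_ring n)" "r \<notin> P"
      unfolding memK mem_local_ring by blast
    have "y * x = Fract (b * a) (r * s)" using a b by simp
    moreover have "r * s \<notin> P" "r * s \<in> carrier (poly_ring n)" "b * a \<in> Q"
      using a b prime(3) closed(4) Qc(4) by auto
    ultimately show "y * x \<in> K" unfolding memK by blast
  qed
  moreover have "(\<lambda>g. Fract g 1) ` J \<subseteq> K"
    unfolding K_def using JQ closed(2) prime(2) by blast
  ultimately have "Idl\<^bsub>local_ring n P\<^esub> ((\<lambda>g. Fract g 1) ` J) \<subseteq> K"
    by (rule L.genideal_minimal)
  moreover fix f assume "f \<in> local_contraction n P J"
  ultimately have f: "f \<in> carrier (poly_ring n)" "Fract f 1 \<in> K"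
    by (auto simp: local_contraction_def)
  then obtain a s where as: "Fract f 1 = Fract a s" "a \<in> Q" "s \<in> carrier (poly_ring n)" "s \<notin> P"
    unfolding memK by blast
  then have "s \<noteq> 0" using prime(1) by auto
  then have "s * f = a" using as(1) by (simp add: eq_fract mult.commute)
  then show "f \<in> Q" using cancel as f by auto
qed

lemma subset_local_contraction:
  assumes "J \<subseteq> carrier (poly_ring n)"
  shows "J \<subseteq> local_contraction n P J"
  using assms unfolding local_contraction_def genideal_def by blast

section \<open>Regular sequences and depth\<close>

lemma mem_Idl_insert:
  fixes g :: "'k::field mpol"
  assumes g: "g \<in> carrier (poly_ring n)" and S: "S \<subseteq> carrier (poly_ring n)"
  shows "x \<in> Idl\<^bsub>poly_ring n\<^esub> (insert g S) \<longleftrightarrow>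
    (\<exists>r\<in>carrier (poly_ring n). \<exists>h\<in>Idl\<^bsub>poly_ring n\<^esub> S. x = r * g + h)"
proof -
  interpret R: cring "poly_ring n :: 'k mpol ring" by (rule cring_poly_ring)
  have "Idl\<^bsub>poly_ring n\<^esub> ({g} \<union> S) = PIdl\<^bsub>poly_ring n\<^esub> g <+>\<^bsub>poly_ring n\<^esub> Idl\<^bsub>poly_ring n\<^esub> S"
    using R.Idl_Un[of "{g}" S] g S by (simp add: R.cgenideal_eq_genideal)
  then show ?thesis by (auto simp: set_add_def' cgenideal_def)
qed

lemma Idl_PIdl_Un:
  fixes g :: "'k::field mpol"
  assumes g: "g \<in> carrier (poly_ring n)" and S: "S \<subseteq> carrier (poly_ring n)"
  shows "Idl\<^bsub>poly_ring n\<^esub> (PIdl\<^bsub>poly_ring n\<^esub> g \<union> S) = Idl\<^bsub>poly_ring n\<^esub> (insert g S)"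
proof -
  interpret R: cring "poly_ring n :: 'k mpol ring" by (rule cring_poly_ring)
  have P: "ideal (PIdl\<^bsub>poly_ring n\<^esub> g) (poly_ring n)" by (rule R.cgenideal_ideal[OF g])
  then have "PIdl\<^bsub>poly_ring n\<^esub> g \<subseteq> carrier (poly_ring n)" using poly_ideal_closed(2) by blast
  then show ?thesis
    using R.Idl_Un[of "PIdl\<^bsub>poly_ring n\<^esub> g" S] R.Idl_Un[of "{g}" S] g S R.Idl_ideal[OF P]
    by (simp add: R.cgenideal_eq_genideal)
qed

text \<open>Regularity on R/(g) without the properness clause, expressed in R itself so that g can
  be replaced by its powers.\<close>

definition nzd_sequence :: "nat \<Rightarrow> 'k::field mpol \<Rightarrow> 'k mpol list \<Rightarrow> bool" where
  "nzd_sequence n g fs \<longleftrightarrow> (\<forall>i<length fs. \<forall>y\<in>carrier (poly_ring n).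
     fs ! i * y \<in> Idl\<^bsub>poly_ring n\<^esub> (insert g (set (take i fs))) \<longrightarrow>
     y \<in> Idl\<^bsub>poly_ring n\<^esub> (insert g (set (take i fs))))"

text \<open>In the regular sequence g, f_1, ..., f_d the element g can be moved past f_1, ..., f_i
  and stays a nonzerodivisor. The base case is g \<noteq> 0 in a domain.\<close>

lemma nzd_modulo_prefix:
  fixes g :: "'k::field mpol"
  assumes g: "g \<in> carrier (poly_ring n)" "g \<noteq> 0" and fs: "set fs \<subseteq> carrier (poly_ring n)"
    and reg: "nzd_sequence n g fs"
    and "i \<le> length fs" and "z \<in> carrier (poly_ring n)" "g * z \<in> Idl\<^bsub>poly_ring n\<^esub> (set (take i fs))"
  shows "z \<in> Idl\<^bsub>poly_ring n\<^esub> (set (take i fs))"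
  using assms(5-7)
proof (induction i arbitrary: z)
  case 0
  interpret R: cring "poly_ring n :: 'k mpol ring" by (rule cring_poly_ring)
  have "{0} \<subseteq> (carrier (poly_ring n) :: 'k mpol set)" using carrier_poly_ring_closed(1) by auto
  have "Idl\<^bsub>poly_ring n\<^esub> {} = ({0} :: 'k mpol set)"
    using Idl_poly_ring(3)[of "{}" n "{0}"] Idl_poly_ring(1)[of "{}" n] R.zeroideal
      poly_ideal_closed(1)[OF Idl_poly_ring(1)[of "{}" n]] by auto
  then show ?case using 0 g by simp
next
  case (Suc i)
  note closed = carrier_poly_ring_closed[where n = n and 'k = 'k]
  let ?H = "Idl\<^bsub>poly_ring n\<^esub> (set (take i fs))" and ?f = "fs ! i"
  have S: "set (take i fs) \<subseteq> carrier (poly_ring n)" using fs set_take_subset[of i fs] by blast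
  note H = poly_ideal_closed[OF Idl_poly_ring(1)[OF S]]
  have f: "?f \<in> carrier (poly_ring n)" using fs Suc.prems(1) by (auto intro: nth_mem)
  have take_Suc: "set (take (Suc i) fs) = insert ?f (set (take i fs))"
    using Suc.prems(1) by (simp add: take_Suc_conv_app_nth)
  note mem_Suc = mem_Idl_insert[OF f S, folded take_Suc]
  obtain r h where rh: "r \<in> carrier (poly_ring n)" "h \<in> ?H" "g * z = r * ?f + h"
    using Suc.prems(3) unfolding mem_Suc by blast
  have "?f * r = z * g + (- h)" using rh(3) by (simp add: algebra_simps)
  then have "?f * r \<in> Idl\<^bsub>poly_ring n\<^esub> (insert g (set (take i fs)))"
    unfolding mem_Idl_insert[OF g(1) S] using Suc.prems(2) H(5)[OF rh(2)] by blast
  then have "r \<in> Idl\<^bsub>poly_ring n\<^esub> (insert g (set (take i fs)))"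
    using reg rh(1) Suc.prems(1) unfolding nzd_sequence_def by simp
  then obtain s h' where s: "s \<in> carrier (poly_ring n)" "h' \<in> ?H" "r = s * g + h'"
    unfolding mem_Idl_insert[OF g(1) S] by blast
  \<comment> \<open>From g z = r f + h, regularity of f modulo g gives r = s g + h'. Subtracting s f
    from z removes the f-term, so the induction hypothesis for the shorter prefix applies.\<close>
  have "g * (z - s * ?f) = ?f * h' + h" using rh(3) s(3) by (simp add: algebra_simps)
  moreover have "?f * h' + h \<in> ?H" by (intro H(3,4) f s rh)
  moreover have "z - s * ?f \<in> carrier (poly_ring n)" by (intro closed Suc.prems(2) s f)
  ultimately have "z - s * ?f \<in> ?H" using Suc.IH[of "z - s * ?f"] Suc.prems(1) by simp
  moreover have "z = s * ?f + (z - s * ?f)" by simp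
  ultimately show ?case unfolding mem_Suc using s(1) by blast
qed

text \<open>Peel off one factor g: f y in (g^(k+1)) + H forces y = y' g + h', cancelling g modulo H
  gives f y' in (g^k) + H, and the induction hypothesis applies to y'.\<close>

lemma nzd_sequence_power:
  fixes g :: "'k::field mpol"
  assumes g: "g \<in> carrier (poly_ring n)" "g \<noteq> 0" and fs: "set fs \<subseteq> carrier (poly_ring n)"
    and reg: "nzd_sequence n g fs"
  shows "nzd_sequence n (g ^ k) fs"
  unfolding nzd_sequence_def
proof (intro allI impI ballI)
  note closed = carrier_poly_ring_closed[where n = n and 'k = 'k]
  fix i y assume i: "i < length fs"
  let ?H = "Idl\<^bsub>poly_ring n\<^esub> (set (take i fs))" and ?f = "fs ! i"
  have S: "set (take i fs) \<subseteq> carrier (poly_ring n)" using fs set_take_subset[of i fs] by blast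
  note H = poly_ideal_closed[OF Idl_poly_ring(1)[OF S]]
  have f: "?f \<in> carrier (poly_ring n)" using fs i by (auto intro: nth_mem)
  note mem = mem_Idl_insert[OF closed(7)[OF g(1)] S]
  assume "y \<in> carrier (poly_ring n)" "?f * y \<in> Idl\<^bsub>poly_ring n\<^esub> (insert (g ^ k) (set (take i fs)))"
  then show "y \<in> Idl\<^bsub>poly_ring n\<^esub> (insert (g ^ k) (set (take i fs)))"
  proof (induction k arbitrary: y)
    case 0
    have "y = y * g ^ 0 + 0" by simp
    then show ?case unfolding mem using 0 H(1) by blast
  next
    case (Suc k)
    obtain r h where rh: "r \<in> carrier (poly_ring n)" "h \<in> ?H" "?f * y = r * g ^ Suc k + h"
      using Suc.prems(2) unfolding mem by blast
    have "?f * y = (r * g ^ k) * g + h" using rh(3) by (simp add: algebra_simps)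
    moreover have "r * g ^ k \<in> carrier (poly_ring n)" by (intro closed rh g)
    ultimately have "?f * y \<in> Idl\<^bsub>poly_ring n\<^esub> (insert g (set (take i fs)))"
      unfolding mem_Idl_insert[OF g(1) S] using rh(2) by blast
    then have "y \<in> Idl\<^bsub>poly_ring n\<^esub> (insert g (set (take i fs)))"
      using reg Suc.prems(1) i unfolding nzd_sequence_def by simp
    then obtain y' h' where y': "y' \<in> carrier (poly_ring n)" "h' \<in> ?H" "y = y' * g + h'"
      unfolding mem_Idl_insert[OF g(1) S] by blast
    have "g * (?f * y' - r * g ^ k) = h - ?f * h'" using rh(3) y'(3) by (simp add: algebra_simps)
    moreover have "h - ?f * h' \<in> ?H" by (intro H(4,6) f y' rh)
    moreover have "?f * y' - r * g ^ k \<in> carrier (poly_ring n)" by (intro closed rh g y' f)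
    ultimately have "?f * y' - r * g ^ k \<in> ?H"
      using nzd_modulo_prefix[OF g fs reg, of i "?f * y' - r * g ^ k"] i by simp
    moreover have "?f * y' = r * g ^ k + (?f * y' - r * g ^ k)" by simp
    ultimately have "?f * y' \<in> Idl\<^bsub>poly_ring n\<^esub> (insert (g ^ k) (set (take i fs)))"
      unfolding mem using rh(1) by blast
    from Suc.IH[OF y'(1) this] obtain r' h'' where r': "r' \<in> carrier (poly_ring n)" "h'' \<in> ?H" "y' = r' * g ^ k + h''"
      unfolding mem by blast
    have "y = r' * g ^ Suc k + (g * h'' + h')" using r'(3) y'(3) by (simp add: algebra_simps)
    moreover have "g * h'' + h' \<in> ?H" by (intro H(3,4) g r' y')
    ultimately show ?case unfolding mem using r'(1) by blast
  qed
qed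

lemma nzd_sequence_power_iff:
  fixes g :: "'k::field mpol"
  assumes g: "g \<in> carrier (poly_ring n)" "g \<noteq> 0" and fs: "set fs \<subseteq> carrier (poly_ring n)" and k: "1 \<le> k"
  shows "nzd_sequence n (g ^ k) fs \<longleftrightarrow> nzd_sequence n g fs"
proof
  assume reg: "nzd_sequence n (g ^ k) fs"
  note closed = carrier_poly_ring_closed[where n = n and 'k = 'k]
  obtain l where l: "k = Suc l" using k by (cases k) auto
  show "nzd_sequence n g fs"
    unfolding nzd_sequence_def
  proof (intro allI impI ballI)
    fix i y assume i: "i < length fs"
    let ?H = "Idl\<^bsub>poly_ring n\<^esub> (set (take i fs))" and ?f = "fs ! i"
    have S: "set (take i fs) \<subseteq> carrier (poly_ring n)" using fs set_take_subset[of i fs] by blast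
    note H = poly_ideal_closed[OF Idl_poly_ring(1)[OF S]]
    note mem = mem_Idl_insert[OF g(1) S] mem_Idl_insert[OF closed(7)[OF g(1)] S]
    assume y: "y \<in> carrier (poly_ring n)" and "?f * y \<in> Idl\<^bsub>poly_ring n\<^esub> (insert g (set (take i fs)))"
    then obtain r h where rh: "r \<in> carrier (poly_ring n)" "h \<in> ?H" "?f * y = r * g + h"
      unfolding mem by blast
    have "?f * (g ^ l * y) = g ^ l * (?f * y)" by (simp add: algebra_simps)
    also have "\<dots> = r * g ^ k + g ^ l * h" unfolding rh(3) l by (simp add: algebra_simps)
    finally have "?f * (g ^ l * y) = r * g ^ k + g ^ l * h" .
    moreover have "g ^ l * h \<in> ?H" by (intro H(4) closed g rh)
    ultimately have "?f * (g ^ l * y) \<in> Idl\<^bsub>poly_ring n\<^esub> (insert (g ^ k) (set (take i fs)))"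
      unfolding mem using rh(1) by blast
    moreover have "g ^ l * y \<in> carrier (poly_ring n)" by (intro closed g y)
    ultimately have "g ^ l * y \<in> Idl\<^bsub>poly_ring n\<^esub> (insert (g ^ k) (set (take i fs)))"
      using reg i unfolding nzd_sequence_def by simp
    then obtain r' h' where r': "r' \<in> carrier (poly_ring n)" "h' \<in> ?H" "g ^ l * y = r' * g ^ k + h'"
      unfolding mem by blast
    \<comment> \<open>Cancellation modulo H is available for g^k, from the assumed regularity, but
      not yet for g; this is why both sides get one more factor g.\<close>
    have "g ^ k * (y - r' * g) = g * (g ^ l * y - r' * g ^ k)" unfolding l by (simp add: algebra_simps)
    also have "\<dots> = g * h'" using r'(3) by simp
    finally have "g ^ k * (y - r' * g) = g * h'" .
    moreover have "g * h' \<in> ?H" by (intro H(4) g r')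
    moreover have "y - r' * g \<in> carrier (poly_ring n)" by (intro closed y r' g)
    ultimately have "y - r' * g \<in> ?H"
      using nzd_modulo_prefix[OF closed(7)[OF g(1)] _ fs reg, of i "y - r' * g"] i g(2) by simp
    moreover have "y = r' * g + (y - r' * g)" by simp
    ultimately show "y \<in> Idl\<^bsub>poly_ring n\<^esub> (insert g (set (take i fs)))" unfolding mem using r'(1) by blast
  qed
qed (rule nzd_sequence_power[OF g fs])

lemma vars_ideal_eq: "j \<le> n \<Longrightarrow> vars_ideal n j = mon_span (weight_ge n {1..j} 1)"
  unfolding vars_ideal_def by (rule Idl_xvar) auto

text \<open>Properness is automatic, since g and all members of the sequence lie in the ideal of the
  variables, which misses 1.\<close>

lemma regular_sequence_PIdl_iff:
  fixes g :: "'k::field mpol"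
  assumes g: "g \<in> vars_ideal n n" and fs: "set fs \<subseteq> vars_ideal n n"
  shows "regular_sequence (poly_ring n) (PIdl\<^bsub>poly_ring n\<^esub> g) fs \<longleftrightarrow> nzd_sequence n g fs"
proof -
  interpret R: cring "poly_ring n :: 'k mpol ring" by (rule cring_poly_ring)
  have m: "ideal (vars_ideal n n :: 'k mpol set) (poly_ring n)"
    unfolding vars_ideal_eq[OF order_refl] by (rule ideal_weight_ge)
  note mc = poly_ideal_closed[OF m]
  have gc: "g \<in> carrier (poly_ring n)" and fsc: "set fs \<subseteq> carrier (poly_ring n)"
    using g fs mc(2) by auto
  have S: "set (take i fs) \<subseteq> carrier (poly_ring n)" for i using fsc set_take_subset[of i fs] by blast
  have "Idl\<^bsub>poly_ring n\<^esub> (PIdl\<^bsub>poly_ring n\<^esub> g \<union> set fs) \<subseteq> vars_ideal n n"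
    unfolding Idl_PIdl_Un[OF gc fsc] using g fs gc fsc
    by (intro Idl_poly_ring(3)[OF _ m]) auto
  moreover have "1 \<notin> (vars_ideal n n :: 'k mpol set)"
    unfolding vars_ideal_eq[OF order_refl] by (rule one_notin_weight_ge)
  ultimately have "Idl\<^bsub>poly_ring n\<^esub> (PIdl\<^bsub>poly_ring n\<^esub> g \<union> set fs) \<noteq> carrier (poly_ring n)"
    using carrier_poly_ring_closed(2) by blast
  moreover have "nonzerodivisor (poly_ring n Quot J) (J +>\<^bsub>poly_ring n\<^esub> fs ! i) \<longleftrightarrow>
      (\<forall>y\<in>carrier (poly_ring n). fs ! i * y \<in> J \<longrightarrow> y \<in> J)"
    if "i < length fs" "J = Idl\<^bsub>poly_ring n\<^esub> (insert g (set (take i fs)))" for i J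
  proof -
    have "ideal J (poly_ring n)" unfolding that(2) using gc S by (intro Idl_poly_ring(1)) auto
    moreover have "fs ! i \<in> carrier (poly_ring n)" using fsc that(1) by (auto intro: nth_mem)
    ultimately show ?thesis using R.nonzerodivisor_Quot_iff[of J "fs ! i"] by simp
  qed
  ultimately show ?thesis
    unfolding regular_sequence_def nzd_sequence_def Let_def Idl_PIdl_Un[OF gc S] using fsc by simp
qed

lemma depth_quot_PIdl_power:
  fixes g :: "'k::field mpol"
  assumes g: "g \<in> vars_ideal n n" "g \<noteq> 0" and k: "1 \<le> k"
  shows "depth_quot n (PIdl\<^bsub>poly_ring n\<^esub> (g ^ k)) = depth_quot n (PIdl\<^bsub>poly_ring n\<^esub> g)"
proof -
  have m: "ideal (vars_ideal n n :: 'k mpol set) (poly_ring n)"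
    unfolding vars_ideal_eq[OF order_refl] by (rule ideal_weight_ge)
  note mc = poly_ideal_closed[OF m]
  obtain l where l: "k = Suc l" using k by (cases k) auto
  have gk: "g ^ k \<in> vars_ideal n n"
    unfolding l power_Suc2 by (intro mc(4) carrier_poly_ring_closed(7) mc(2) g)
  have "regular_sequence (poly_ring n) (PIdl\<^bsub>poly_ring n\<^esub> (g ^ k)) fs \<longleftrightarrow>
      regular_sequence (poly_ring n) (PIdl\<^bsub>poly_ring n\<^esub> g) fs" if "set fs \<subseteq> vars_ideal n n" for fs
    unfolding regular_sequence_PIdl_iff[OF gk that] regular_sequence_PIdl_iff[OF g(1) that]
    using that mc(2) g by (intro nzd_sequence_power_iff k) auto
  then have "{fs. regular_sequence (poly_ring n) (PIdl\<^bsub>poly_ring n\<^esub> (g ^ k)) fs \<and> set fs \<subseteq> vars_ideal n n} =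
    {fs. regular_sequence (poly_ring n) (PIdl\<^bsub>poly_ring n\<^esub> g) fs \<and> set fs \<subseteq> vars_ideal n n}" by auto
  then show ?thesis unfolding depth_quot_def by simp
qed

text \<open>The annihilated element y is nonzero modulo J and is killed by every element of the
  maximal ideal, so no regular sequence inside that ideal can start.\<close>

lemma depth_quot_eq_0:
  fixes J :: "'k::field mpol set"
  assumes J: "ideal J (poly_ring n)" and Ass: "vars_ideal n n \<in> Ass (poly_ring n) J"
  shows "depth_quot n J = 0"
proof -
  interpret R: cring "poly_ring n :: 'k mpol ring" by (rule cring_poly_ring)
  obtain y where y: "y \<in> carrier (poly_ring n)"
    and eq: "vars_ideal n n = {f \<in> carrier (poly_ring n). f * y \<in> J}"
    using Ass unfolding R.Ass_iff[OF J] by auto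
  have "1 \<notin> (vars_ideal n n :: 'k mpol set)"
    unfolding vars_ideal_eq[OF order_refl] by (rule one_notin_weight_ge)
  then have "y \<notin> J" using eq carrier_poly_ring_closed(2) by auto
  have "fs = []" if reg: "regular_sequence (poly_ring n) J fs" and fs: "set fs \<subseteq> vars_ideal n n" for fs
  proof (rule ccontr)
    assume "fs \<noteq> []"
    then have "nonzerodivisor (poly_ring n Quot J) (J +>\<^bsub>poly_ring n\<^esub> fs ! 0)"
      using reg R.Idl_ideal[OF J] unfolding regular_sequence_def Let_def by force
    moreover have "fs ! 0 \<in> vars_ideal n n" using fs \<open>fs \<noteq> []\<close> by (auto intro: nth_mem)
    ultimately show False
      using R.nonzerodivisor_Quot_iff[OF J, of "fs ! 0"] y \<open>y \<notin> J\<close> eq by auto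
  qed
  then have "depth_quot n J \<le> 0" unfolding depth_quot_def by (intro SUP_least) (auto simp: zero_enat_def)
  then show ?thesis by simp
qed

lemma mon_span_divisible:
  fixes \<kappa> :: expo
  assumes "\<kappa> \<in> expos n"
  shows "mon_span {\<mu> \<in> expos n. \<forall>i\<in>{1..n}. lookup \<kappa> i \<le> lookup \<mu> i} = (PIdl\<^bsub>poly_ring n\<^esub> (xpow \<kappa>) :: 'k::field mpol set)"
    (is "mon_span ?S = _")
proof (rule subset_antisym)
  interpret R: cring "poly_ring n :: 'k mpol ring" by (rule cring_poly_ring)
  have c: "xpow \<kappa> \<in> (carrier (poly_ring n) :: 'k mpol set)" using assms by (simp add: carrier_poly_ring)
  have "xpow \<mu> \<in> (PIdl\<^bsub>poly_ring n\<^esub> (xpow \<kappa>) :: 'k mpol set)" if \<mu>: "\<mu> \<in> ?S" for \<mu>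
  proof -
    have "lookup \<kappa> i \<le> lookup \<mu> i" for i
      using \<mu> expos_lookup_eq_0[OF assms, of i] by (cases "i \<in> {1..n}") auto
    then have "\<mu> = (\<mu> - \<kappa>) + \<kappa>" by (intro poly_mapping_eqI) (simp add: lookup_add lookup_minus)
    then have "xpow \<mu> = xpow (\<mu> - \<kappa>) * (xpow \<kappa> :: 'k mpol)" by (metis xpow_add)
    moreover have "\<mu> - \<kappa> \<in> expos n"
      using \<mu> by (auto simp: expos_def in_keys_iff lookup_minus subset_iff)
    then have "xpow (\<mu> - \<kappa>) \<in> (carrier (poly_ring n) :: 'k mpol set)" by (simp add: carrier_poly_ring)
    ultimately show ?thesis by (auto simp: cgenideal_def)
  qed
  then show "mon_span ?S \<subseteq> (PIdl\<^bsub>poly_ring n\<^esub> (xpow \<kappa>) :: 'k mpol set)"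
    by (intro mon_span_subset[OF R.cgenideal_ideal[OF c]]) auto
  show "PIdl\<^bsub>poly_ring n\<^esub> (xpow \<kappa>) \<subseteq> (mon_span ?S :: 'k mpol set)"
  proof
    fix p assume "p \<in> (PIdl\<^bsub>poly_ring n\<^esub> (xpow \<kappa>) :: 'k mpol set)"
    then obtain r where r: "r \<in> carrier (poly_ring n)" "p = xpow \<kappa> * r"
      by (auto simp: cgenideal_def mult.commute)
    then show "p \<in> mon_span ?S"
      using assms by (auto simp: mon_span_def keys_xpow_mult carrier_poly_ring lookup_add intro!: expos_add)
  qed
qed

lemma xpow_power: "\<exists>\<kappa>'. xpow \<kappa> ^ k = (xpow \<kappa>' :: 'k::field mpol) \<and> (\<forall>i. lookup \<kappa>' i = k * lookup \<kappa> i)"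
proof (induction k)
  case 0
  show ?case by (intro exI[of _ 0]) simp
next
  case (Suc k)
  then obtain \<kappa>' where "xpow \<kappa> ^ k = (xpow \<kappa>' :: 'k mpol)" "\<forall>i. lookup \<kappa>' i = k * lookup \<kappa> i" by blast
  then show ?case by (intro exI[of _ "\<kappa> + \<kappa>'"]) (simp add: xpow_add lookup_add)
qed

section \<open>The limit set of associated primes\<close>

lemma prefix_sum_1: "prefix_sum g 1 = g 1" "prefix_sum g (card {i}) = g 1"
  by (simp_all add: prefix_sum_def One_nat_def)

text \<open>Both cases of the theorem at once: if \<lambda>_1 = 0 the positive indices allowed up to
  n are those with \<lambda>_j > 0, that is j \<ge> j'. The index 0, which would stand for the zero
  ideal, is excluded.\<close>

definition limit_index :: "expo \<Rightarrow> nat \<Rightarrow> bool" where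
  "limit_index lam j \<longleftrightarrow> j = 1 \<and> 0 < lookup lam 1 \<or> 1 < j \<and> lookup lam j \<noteq> lookup lam 1"

lemma deficit_one_bij:
  assumes "bij_betw h A B" "deficit_one t B" "finite A"
  shows "deficit_one t A"
proof -
  obtain g where g: "(\<Sum>i\<in>B. g i) + 1 = t (card B)" "\<And>C. C \<subset> B \<Longrightarrow> t (card C) \<le> (\<Sum>i\<in>C. g i)"
    using assms(2) unfolding deficit_one_def by blast
  have inj: "inj_on h A" and im: "h ` A = B" using assms(1) by (auto simp: bij_betw_def)
  have "(\<Sum>i\<in>A. g (h i)) + 1 = t (card A)"
    using g(1) sum.reindex_bij_betw[OF assms(1), of g] bij_betw_same_card[OF assms(1)] by simp
  moreover have "t (card C) \<le> (\<Sum>i\<in>C. g (h i))" if C: "C \<subset> A" for C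
  proof -
    have injC: "inj_on h C" using inj C by (meson inj_on_subset psubsetE)
    have "h ` C \<subset> B" using image_strict_mono[OF inj C] im by simp
    from g(2)[OF this] show ?thesis by (simp add: card_image[OF injC] sum.reindex[OF injC])
  qed
  ultimately show ?thesis unfolding deficit_one_def by blast
qed

text \<open>The bounds depend on cardinality only, so a witness can be transported along any
  bijection and initial segments suffice.\<close>

lemma deficit_one_card:
  assumes "finite A"
  shows "deficit_one t A \<longleftrightarrow> deficit_one t {1..card A}"
proof -
  obtain h where h: "bij_betw h A {1..card A}"
    using finite_same_card_bij[OF assms, of "{1..card A}"] by auto
  show ?thesis
    using deficit_one_bij[OF h _ assms] deficit_one_bij[OF bij_betw_inv_into[OF h]] by blast
qed

lemma partition_le: "lam \<in> partitions n \<Longrightarrow> 1 \<le> i \<Longrightarrow> i \<le> j \<Longrightarrow> j \<le> n \<Longrightarrow> lookup lam i \<le> lookup lam j"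
  by (auto simp: partitions_def)

lemma prefix_sum_const:
  assumes "lam \<in> partitions n" "lookup lam j = lookup lam 1" "j \<le> n" "m \<le> j"
  shows "prefix_sum (lookup lam) m = m * lookup lam 1"
proof -
  have "lookup lam i = lookup lam 1" if "i \<in> {1..m}" for i
  proof (rule antisym)
    show "lookup lam i \<le> lookup lam 1"
      using partition_le[OF assms(1), of i j] assms(2-4) that by auto
    show "lookup lam 1 \<le> lookup lam i"
      using partition_le[OF assms(1), of 1 i] assms(2-4) that by auto
  qed
  then have "prefix_sum (lookup lam) m = (\<Sum>i\<in>{1..m}. lookup lam 1)"
    unfolding prefix_sum_def by (rule sum.cong[OF refl])
  then show ?thesis by simp
qed

text \<open>If j > 1 and \<lambda>_j = \<lambda>_1, the singletons are proper subsets and already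
  force the total to reach k f(j), leaving no deficit. The argument is uniform in k.\<close>

lemma limit_index_if_deficit_one:
  assumes lam: "lam \<in> partitions n" and j: "j \<le> n"
    and def: "deficit_one (\<lambda>m. k * prefix_sum (lookup lam) m) {1..j}"
  shows "limit_index lam j"
proof -
  obtain g where g: "(\<Sum>i\<in>{1..j}. g i) + 1 = k * prefix_sum (lookup lam) j"
    "\<And>B. B \<subset> {1..j} \<Longrightarrow> k * prefix_sum (lookup lam) (card B) \<le> (\<Sum>i\<in>B. g i)"
    using def unfolding deficit_one_def by auto
  consider "j = 0" | "j = 1" | "1 < j" by linarith
  then show ?thesis
  proof cases
    case 1
    then show ?thesis using g(1) by simp
  next
    case 2
    then have "g 1 + 1 = k * lookup lam 1" using g(1) by (simp add: prefix_sum_def)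
    then show ?thesis using 2 by (cases "lookup lam 1") (auto simp: limit_index_def)
  next
    case 3
    have "lookup lam j \<noteq> lookup lam 1"
    proof
      assume eq: "lookup lam j = lookup lam 1"
      have "k * lookup lam 1 \<le> g i" if "i \<in> {1..j}" for i
      proof -
        have "{i} \<subset> {1..j}" using that 3 by (metis atLeastAtMost_singleton_iff empty_subsetI insert_subset less_irrefl psubsetI)
        from g(2)[OF this] show ?thesis unfolding prefix_sum_1 by simp
      qed
      then have "(\<Sum>i\<in>{1..j}. k * lookup lam 1) \<le> (\<Sum>i\<in>{1..j}. g i)" by (rule sum_mono)
      moreover have "prefix_sum (lookup lam) j = j * lookup lam 1"
        by (rule prefix_sum_const[OF lam eq j order_refl])
      ultimately show False using g(1) by (simp add: algebra_simps)
    qed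
    then show ?thesis using 3 by (simp add: limit_index_def)
  qed
qed

text \<open>
  If \<open>p\<close> is the last index with \<open>\<lambda>\<^sub>p < \<lambda>\<^sub>j\<close>, the entries \<open>k\<lambda>\<^sub>i\<close> for \<open>p < i \<le> j\<close> are lowered by one
  and all but one of the units are put on the entry \<open>k\<lambda>\<^sub>p\<close>.
\<close>

lemma deficit_one_if_limit_index:
  assumes lam: "lam \<in> partitions n" and j: "j \<le> n" and L: "limit_index lam j" and k: "1 \<le> k"
    and gap: "j = 1 \<or> lookup lam (j - 1) < lookup lam j \<or> j - 1 \<le> k"
  shows "deficit_one (\<lambda>m. k * prefix_sum (lookup lam) m) {1..j}"
proof (cases "j = 1")
  case True
  have pos: "0 < k * lookup lam 1" using L True k by (simp add: limit_index_def)
  have sum: "(\<Sum>i\<in>{1..1::nat}. k * lookup lam 1 - 1) + 1 = k * prefix_sum (lookup lam) (card {1..1::nat})"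
    unfolding atLeastAtMost_singleton prefix_sum_1 using pos by (simp del: nat_0_less_mult_iff)
  have sub: "k * prefix_sum (lookup lam) (card B) \<le> (\<Sum>i\<in>B. k * lookup lam 1 - 1)"
    if "B \<subset> {1..1::nat}" for B
  proof -
    have "B = {}" using that by auto
    then show ?thesis by simp
  qed
  show ?thesis
    unfolding True deficit_one_def
    by (rule exI[of _ "\<lambda>_. k * lookup lam 1 - 1"], intro conjI allI impI sum sub)
next
  case False
  then have j1: "1 < j" and ne: "lookup lam j \<noteq> lookup lam 1" using L by (auto simp: limit_index_def)
  have lt1: "lookup lam 1 < lookup lam j" using partition_le[OF lam, of 1 j] j j1 ne by simp
  let ?M = "{i \<in> {1..<j}. lookup lam i < lookup lam j}"
  define p where "p = Max ?M"
  have "1 \<in> ?M" using lt1 j1 by simp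
  then have "p \<in> ?M" unfolding p_def by (intro Max_in) auto
  then have p: "1 \<le> p" "p < j" "lookup lam p < lookup lam j" by auto
  have p_max: "i \<le> p" if "i \<in> ?M" for i unfolding p_def using that by (intro Max_ge) auto
  have top: "lookup lam i = lookup lam j" if "p < i" "i \<le> j" for i
  proof (rule ccontr)
    assume "lookup lam i \<noteq> lookup lam j"
    then have "lookup lam i < lookup lam j" "i \<noteq> j" using partition_le[OF lam, of i j] that j p by fastforce+
    then have "i \<in> ?M" using that p by auto
    then show False using p_max[of i] that by simp
  qed
  \<comment> \<open>The length of the final block of parts equal to \<lambda>_j: it is 1 if
    \<lambda>_(j-1) < \<lambda>_j and at most j - 1 otherwise, so \<open>gap\<close> yields b \<le>
    k.\<close>
  define b where "b = j - p"
  have b1: "1 \<le> b" using p b_def by simp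
  have bk: "b \<le> k"
  proof (cases "lookup lam (j - 1) < lookup lam j")
    case True
    then have "j - 1 \<le> p" using p_max[of "j - 1"] j1 by simp
    then show ?thesis using k b_def p by simp
  next
    case F: False
    then show ?thesis using gap False b_def p by simp
  qed
  \<comment> \<open>Room for the b - 1 extra units at p: together with b \<le> k this keeps the
    entry at p at or below k \<lambda>_j - 1.\<close>
  have kp: "k * lookup lam p + k \<le> k * lookup lam j"
  proof -
    have "k * Suc (lookup lam p) \<le> k * lookup lam j" using p(3) by (intro mult_le_mono2) simp
    then show ?thesis by simp
  qed
  define g where "g i = (if i < p then k * lookup lam i else if i = p then k * lookup lam p + (b - 1)
    else k * lookup lam j - 1)" for i
  \<comment> \<open>Sortedness reduces the inequalities for all B to those for initial
    segments.\<close>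
  have mono: "mono_on {1..j} g"
  proof (rule mono_onI)
    fix r s assume rs: "r \<in> {1..j}" "s \<in> {1..j}" "r \<le> s"
    have 1: "k * lookup lam r \<le> k * lookup lam s" using partition_le[OF lam, of r s] rs j by simp
    have 2: "k * lookup lam r \<le> k * lookup lam p" if "r \<le> p" using partition_le[OF lam, of r p] rs j p that by simp
    define a where "a i = k * lookup lam i" for i
    show "g r \<le> g s"
      using rs(3) 1 2 kp bk b1 unfolding g_def a_def[symmetric] by (auto split: if_splits)
  qed
  have low: "prefix_sum g m = k * prefix_sum (lookup lam) m" if "m < p" for m
    using that by (induction m) (auto simp: g_def algebra_simps)
  \<comment> \<open>The surplus over k f(m) is (b - 1) - (m - p), stated without subtraction of the
    sums: it is nonnegative for m < j and equals -1 at m = j.\<close>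
  have high: "prefix_sum g m + (m - p) = k * prefix_sum (lookup lam) m + (b - 1)" if "p \<le> m" "m \<le> j" for m
    using that
  proof (induction m rule: dec_induct)
    case base
    obtain q where q: "p = Suc q" using p(1) by (cases p) auto
    have "g p = k * lookup lam p + (b - 1)" by (simp add: g_def)
    then show ?case using low[of q] unfolding q by (simp add: algebra_simps)
  next
    case (step m)
    have "1 \<le> k * lookup lam j" using kp k by simp
    then have "g (Suc m) + 1 = k * lookup lam (Suc m)"
      using step top[of "Suc m"] by (simp add: g_def)
    then show ?case using step by (simp add: algebra_simps Suc_diff_le)
  qed
  have "(\<Sum>i\<in>{1..j}. g i) + 1 = k * prefix_sum (lookup lam) (card {1..j})"
    using high[of j] p b1 unfolding b_def by (simp add: prefix_sum_def[of g])
  moreover have "k * prefix_sum (lookup lam) (card B) \<le> (\<Sum>i\<in>B. g i)" if B: "B \<subset> {1..j}" for B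
  proof -
    have "card B < j" using psubset_card_mono[OF _ B] by simp
    then have "k * prefix_sum (lookup lam) (card B) \<le> prefix_sum g (card B)"
      using low[of "card B"] high[of "card B"] unfolding b_def by (cases "card B < p") auto
    also have "\<dots> \<le> (\<Sum>i\<in>B. g i)" using B mono by (intro prefix_sum_le_sum) auto
    finally show ?thesis .
  qed
  ultimately show ?thesis unfolding deficit_one_def by blast
qed

section \<open>Stability of associated primes and depth\<close>

definition limit_primes :: "nat \<Rightarrow> expo \<Rightarrow> 'k::field mpol set set" where
  "limit_primes n lam = {mon_span (weight_ge n A 1) | A. A \<subseteq> {1..n} \<and> limit_index lam (card A)}"

text \<open>Exactly what \<open>deficit_one_if_limit_index\<close> asks of k, for all limit indices
  together. The condition persists for larger k.\<close>

definition stable_exponent :: "nat \<Rightarrow> expo \<Rightarrow> nat \<Rightarrow> bool" where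
  "stable_exponent n lam k \<longleftrightarrow> 1 \<le> k \<and>
     (\<forall>j\<le>n. limit_index lam j \<longrightarrow> j = 1 \<or> lookup lam (j - 1) < lookup lam j \<or> j - 1 \<le> k)"

lemma stable_exponent_mono: "stable_exponent n lam k \<Longrightarrow> k \<le> l \<Longrightarrow> stable_exponent n lam l"
  unfolding stable_exponent_def by (meson le_trans)

lemma Ass_power_Sss:
  assumes lam: "lam \<in> partitions n" and k: "stable_exponent n lam k"
  shows "Ass (poly_ring n) (ideal_power (poly_ring n) (Sss n {lam}) k) = (limit_primes n lam :: 'k::field mpol set set)"
proof -
  have "deficit_one (\<lambda>m. k * prefix_sum (lookup lam) m) A \<longleftrightarrow> limit_index lam (card A)" if A: "A \<subseteq> {1..n}" for A
  proof -
    have fin: "finite A" using A finite_subset by blast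
    have "card A \<le> n" using card_mono[OF _ A] by simp
    then show ?thesis
      unfolding deficit_one_card[OF fin]
      using limit_index_if_deficit_one[OF lam] deficit_one_if_limit_index[OF lam] k
      unfolding stable_exponent_def by blast
  qed
  then show ?thesis
    unfolding ideal_power_Sss[OF lam] limit_primes_def by (subst Ass_contrapolymatroid) auto
qed

lemma ex_permutes_image:
  assumes A: "A \<subseteq> {1..n}"
  obtains \<sigma> where "\<sigma> permutes {1..n}" "\<sigma> ` {1..card A} = A"
proof -
  have fin: "finite A" using A finite_subset by blast
  have le: "card A \<le> n" using card_mono[OF _ A] by simp
  obtain f where f: "bij_betw f {1..card A} A"
    using finite_same_card_bij[of "{1..card A}" A] fin by auto
  have "card ({1..n} - A) = card {card A + 1..n}"
    using card_Diff_subset[OF fin A] by simp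
  then obtain h where h: "bij_betw h {card A + 1..n} ({1..n} - A)"
    using finite_same_card_bij[of "{card A + 1..n}" "{1..n} - A"] by auto
  define \<sigma> where "\<sigma> i = (if i \<in> {1..card A} then f i else if i \<in> {1..n} then h i else i)" for i
  have 1: "bij_betw \<sigma> {1..card A} A"
    using f by (rule bij_betw_cong[THEN iffD1, rotated]) (simp add: \<sigma>_def)
  have 2: "bij_betw \<sigma> {card A + 1..n} ({1..n} - A)"
    using h by (rule bij_betw_cong[THEN iffD1, rotated]) (auto simp: \<sigma>_def)
  have "bij_betw \<sigma> ({1..card A} \<union> {card A + 1..n}) (A \<union> ({1..n} - A))"
    by (rule bij_betw_combine[OF 1 2]) auto
  moreover have "{1..card A} \<union> {card A + 1..n} = {1..n}" using le by auto
  moreover have "A \<union> ({1..n} - A) = {1..n}" using A by auto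
  ultimately have "bij_betw \<sigma> {1..n} {1..n}" by simp
  then have "\<sigma> permutes {1..n}" using le by (intro bij_imp_permutes) (auto simp: \<sigma>_def)
  with 1 show thesis using that by (auto simp: bij_betw_def)
qed

text \<open>A prime generated by variables is determined by its index set A, and A is the image of
  \<open>{1..card A}\<close> under some permutation. Q stands for the two index conditions of the
  theorem.\<close>

lemma limit_primes_eq:
  assumes "\<And>j. 1 \<le> j \<Longrightarrow> j \<le> n \<Longrightarrow> Q j \<longleftrightarrow> limit_index lam j" "\<And>j. Q j \<Longrightarrow> 1 \<le> j \<and> j \<le> n"
  shows "{permute_vars \<sigma> ` vars_ideal n j | \<sigma> j. \<sigma> permutes {1..n} \<and> Q j} = (limit_primes n lam :: 'k::field mpol set set)"
proof (intro subset_antisym subsetI)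
  fix P :: "'k mpol set" assume "P \<in> {permute_vars \<sigma> ` vars_ideal n j | \<sigma> j. \<sigma> permutes {1..n} \<and> Q j}"
  then obtain \<sigma> j where P: "P = permute_vars \<sigma> ` vars_ideal n j" "\<sigma> permutes {1..n}" "Q j" by blast
  have j: "1 \<le> j" "j \<le> n" "limit_index lam j" using assms P(3) by auto
  have "P = mon_span (weight_ge n (\<sigma> ` {1..j}) 1)"
    unfolding P(1) by (rule permute_vars_vars_ideal[OF P(2) j(2)])
  moreover have "\<sigma> ` {1..j} \<subseteq> {1..n}" using permutes_image[OF P(2)] j(2) by auto
  moreover have "card (\<sigma> ` {1..j}) = j" using permutes_inj_on[OF P(2)] by (simp add: card_image)
  ultimately show "P \<in> limit_primes n lam" unfolding limit_primes_def using j(3) by auto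
next
  fix P :: "'k mpol set" assume "P \<in> limit_primes n lam"
  then obtain A where A: "P = mon_span (weight_ge n A 1)" "A \<subseteq> {1..n}" "limit_index lam (card A)"
    unfolding limit_primes_def by blast
  have le: "card A \<le> n" using card_mono[OF _ A(2)] by simp
  moreover have "1 \<le> card A" using A(3) by (auto simp: limit_index_def)
  ultimately have "Q (card A)" using assms(1) A(3) by blast
  moreover obtain \<sigma> where \<sigma>: "\<sigma> permutes {1..n}" "\<sigma> ` {1..card A} = A" by (rule ex_permutes_image[OF A(2)])
  moreover have "P = permute_vars \<sigma> ` vars_ideal n (card A)"
    unfolding A(1) permute_vars_vars_ideal[OF \<sigma>(1) le] \<sigma>(2) ..
  ultimately show "P \<in> {permute_vars \<sigma> ` vars_ideal n j | \<sigma> j. \<sigma> permutes {1..n} \<and> Q j}" by blast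
qed

text \<open>\<open>astab\<close> is a least index and may lie below K, but from it on the sets agree
  with the one at K, so the limit is already attained there.\<close>

lemma astab_Sss:
  fixes I :: "'k::field mpol set"
  assumes lam: "lam \<in> partitions n" and I: "I = Sss n {lam}" and K: "stable_exponent n lam K"
  shows "astab n I \<le> K" "1 \<le> astab n I" "Ass_inf n I = limit_primes n lam"
    "\<And>k. astab n I \<le> k \<Longrightarrow> Ass (poly_ring n) (ideal_power (poly_ring n) I k) = limit_primes n lam"
proof -
  let ?A = "\<lambda>k. Ass (poly_ring n) (ideal_power (poly_ring n) I k)"
  let ?Q = "\<lambda>k0. 1 \<le> k0 \<and> (\<forall>k\<ge>k0. ?A k = ?A k0)"
  have AK: "?A k = limit_primes n lam" if "K \<le> k" for k
    unfolding I by (rule Ass_power_Sss[OF lam stable_exponent_mono[OF K that]])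
  have QK: "?Q K" using K AK by (simp add: stable_exponent_def)
  have as: "astab n I = (LEAST k0. ?Q k0)" by (simp add: astab_def)
  show le: "astab n I \<le> K" unfolding as by (rule Least_le) (rule QK)
  have Q: "?Q (astab n I)" unfolding as by (rule LeastI) (rule QK)
  show "1 \<le> astab n I" using Q by simp
  have "?A K = ?A (astab n I)" using Q le by blast
  then have eq: "?A (astab n I) = limit_primes n lam" using AK[OF order_refl] by (rule trans[OF sym])
  then show "Ass_inf n I = limit_primes n lam" by (simp add: Ass_inf_def)
  show "?A k = limit_primes n lam" if "astab n I \<le> k" for k
  proof -
    have "?A k = ?A (astab n I)" using Q that by blast
    then show ?thesis using eq by (rule trans)
  qed
qed

lemma dstab_bounds:
  assumes "1 \<le> k0" "\<And>k. k0 \<le> k \<Longrightarrow> depth_quot n (ideal_power (poly_ring n) I k) = d"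
  shows "dstab n I \<le> k0" "1 \<le> dstab n I"
proof -
  let ?d = "\<lambda>k. depth_quot n (ideal_power (poly_ring n) I k)"
  let ?Q = "\<lambda>k0. 1 \<le> k0 \<and> (\<forall>k\<ge>k0. ?d k = ?d k0)"
  have Q: "?Q k0" using assms by simp
  have eq: "dstab n I = (LEAST k0. ?Q k0)" by (simp add: dstab_def)
  show "dstab n I \<le> k0" unfolding eq by (rule Least_le) (rule Q)
  have "?Q (dstab n I)" unfolding eq by (rule LeastI) (rule Q)
  then show "1 \<le> dstab n I" by simp
qed

text \<open>The maximal ideal is the limit prime of \<open>{1..n}\<close>. Starting at
  \<open>astab\<close> rather than at K is what makes \<open>dstab\<close> at most
  \<open>astab\<close>.\<close>

lemma depth_eq_0_if_limit_index:
  fixes I :: "'k::field mpol set"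
  assumes lam: "lam \<in> partitions n" and I: "I = Sss n {lam}" and K: "stable_exponent n lam K"
    and n: "limit_index lam n" and k: "astab n I \<le> k"
  shows "depth_quot n (ideal_power (poly_ring n) I k) = 0"
proof (rule depth_quot_eq_0)
  show "ideal (ideal_power (poly_ring n) I k) (poly_ring n)"
    unfolding I ideal_power_Sss[OF lam] by (rule ideal_mon_span[OF upset_contrapolymatroid])
  have "vars_ideal n n \<in> (limit_primes n lam :: 'k mpol set set)"
    unfolding limit_primes_def vars_ideal_eq[OF order_refl] using n by (intro CollectI exI[of _ "{1..n}"]) simp
  then show "vars_ideal n n \<in> Ass (poly_ring n) (ideal_power (poly_ring n) I k)"
    using astab_Sss(4)[OF lam I K k] by simp
qed

section \<open>Constant partitions and symbolic powers\<close>

lemma nonzero_partition: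
  assumes "lam \<in> partitions n" "lam \<noteq> 0"
  obtains i where "i \<in> {1..n}" "0 < lookup lam i"
proof -
  have "keys lam \<noteq> {}" using assms(2) by simp
  then obtain i where i: "i \<in> keys lam" by blast
  then have "i \<in> {1..n}" using partitions_expos[OF assms(1)] by (auto simp: expos_def)
  moreover have "0 < lookup lam i" using i by (simp add: in_keys_iff)
  ultimately show thesis using that by blast
qed

text \<open>For constant parts the singleton inequalities imply all others, so the exponents are the
  multiples of x^(k lam): the power is principal, and its depth does not depend on k.\<close>

lemma depth_constant_partition:
  fixes I :: "'k::field mpol set"
  assumes lam: "lam \<in> partitions n" "lam \<noteq> 0" and I: "I = Sss n {lam}"
    and const: "lookup lam n = lookup lam 1" and k: "1 \<le> k"
  shows "depth_quot n (ideal_power (poly_ring n) I k) = depth_quot n (PIdl\<^bsub>poly_ring n\<^esub> (xpow lam) :: 'k mpol set)"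
proof -
  have "ideal_power (poly_ring n) I k = (PIdl\<^bsub>poly_ring n\<^esub> (xpow lam ^ k) :: 'k mpol set)"
  proof -
    obtain \<kappa> where \<kappa>: "xpow lam ^ k = (xpow \<kappa> :: 'k mpol)" "\<And>i. lookup \<kappa> i = k * lookup lam i"
      using xpow_power by blast
    have expo: "\<kappa> \<in> expos n"
      using partitions_expos[OF lam(1)] \<kappa>(2) by (auto simp: expos_def in_keys_iff subset_iff)
    have c: "lookup lam i = lookup lam 1" if "i \<in> {1..n}" for i
      using partition_le[OF lam(1), of 1 i] partition_le[OF lam(1), of i n] const that by auto
    have "contrapolymatroid n (\<lambda>m. k * prefix_sum (lookup lam) m) =
      {\<mu> \<in> expos n. \<forall>i\<in>{1..n}. lookup \<kappa> i \<le> lookup \<mu> i}" (is "?l = ?r")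
    proof (intro subset_antisym subsetI)
      fix \<mu> assume \<mu>: "\<mu> \<in> ?l"
      have "lookup \<kappa> i \<le> lookup \<mu> i" if "i \<in> {1..n}" for i
        using contrapolymatroidD[OF \<mu>, of "{i}"] that c[OF that] unfolding prefix_sum_1
        by (simp add: \<kappa>(2) weight_def)
      then show "\<mu> \<in> ?r" using \<mu> by (simp add: contrapolymatroid_def)
    next
      fix \<mu> assume \<mu>: "\<mu> \<in> ?r"
      have "k * prefix_sum (lookup lam) (card B) \<le> weight B \<mu>" if B: "B \<subseteq> {1..n}" for B
      proof -
        have "card B \<le> n" using card_mono[OF _ B] by simp
        then have "k * prefix_sum (lookup lam) (card B) = (\<Sum>i\<in>B. k * lookup lam 1)"
          using prefix_sum_const[OF lam(1) const order_refl] by simp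
        also have "\<dots> \<le> weight B \<mu>"
          unfolding weight_def
        proof (rule sum_mono)
          fix i assume "i \<in> B"
          then have i: "i \<in> {1..n}" using B by auto
          then have "lookup \<kappa> i \<le> lookup \<mu> i" using \<mu> by blast
          then show "k * lookup lam 1 \<le> lookup \<mu> i" unfolding \<kappa>(2) c[OF i] .
        qed
        finally show ?thesis .
      qed
      then show "\<mu> \<in> ?l" using \<mu> by (simp add: contrapolymatroid_def)
    qed
    then show ?thesis unfolding I ideal_power_Sss[OF lam(1)] \<kappa>(1) mon_span_divisible[OF expo, symmetric] by simp
  qed
  moreover have "xpow lam \<in> (vars_ideal n n :: 'k mpol set)"
  proof -
    obtain i where i: "i \<in> {1..n}" "0 < lookup lam i" by (rule nonzero_partition[OF lam])
    then have "1 \<le> weight {1..n} lam" using i lookup_le_weight[of "{1..n}" i lam] by simp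
    then show ?thesis
      unfolding vars_ideal_eq[OF order_refl] using partitions_expos[OF lam(1)] by (simp add: weight_ge_def)
  qed
  moreover have "xpow lam \<noteq> (0 :: 'k mpol)"
    by (simp flip: keys_eq_empty)
  ultimately show ?thesis using depth_quot_PIdl_power k by metis
qed

text \<open>Stability at exponent 1 makes Ass(I) the full limit set. Contraction at the prime of A
  recovers the inequality for A, and the inequalities of the other sets follow from these.\<close>

lemma symbolic_power_Sss:
  fixes I :: "'k::field mpol set"
  assumes lam: "lam \<in> partitions n" and n: "1 \<le> n" "0 < lookup lam n" and I: "I = Sss n {lam}"
    and one: "stable_exponent n lam 1"
  shows "symbolic_power n I k = ideal_power (poly_ring n) I k"
proof -
  let ?f = "\<lambda>m. prefix_sum (lookup lam) m"
  let ?J = "mon_span (contrapolymatroid n (\<lambda>m. k * ?f m)) :: 'k mpol set"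
  have J: "ideal_power (poly_ring n) I k = ?J" unfolding I by (rule ideal_power_Sss[OF lam])
  have "ideal_power (poly_ring n) I 1 = I"
    using ideal_power_Sss[OF lam, of 1, where 'k = 'k] Sss_eq_mon_span[OF lam, where 'k = 'k] by (simp add: I)
  then have Ass: "Ass (poly_ring n) I = limit_primes n lam"
    using Ass_power_Sss[OF lam one, where 'k = 'k] I by simp
  have contraction: "local_contraction n (mon_span (weight_ge n A 1)) ?J \<subseteq> mon_span (weight_ge n A (k * ?f (card A)))"
    if A: "A \<subseteq> {1..n}" for A
  proof (rule local_contraction_subset[OF primeideal_weight_ge ideal_weight_ge])
    show "?J \<subseteq> mon_span (weight_ge n A (k * ?f (card A)))"
      using A by (intro mon_span_mono) (auto simp: contrapolymatroid_def weight_ge_def)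
  qed (rule mem_weight_ge_cancel)
  have "symbolic_power n I k \<subseteq> ?J"
  proof
    fix p assume "p \<in> symbolic_power n I k"
    then have p: "p \<in> local_contraction n (mon_span (weight_ge n A 1)) ?J"
      if "A \<subseteq> {1..n}" "limit_index lam (card A)" for A
      using that unfolding symbolic_power_def Ass J limit_primes_def by blast
    have w: "k * ?f (card A) \<le> weight A \<mu>" if "A \<subseteq> {1..n}" "limit_index lam (card A)" "\<mu> \<in> keys p" for A \<mu>
      using p[OF that(1,2)] contraction[OF that(1)] that(3) by (auto simp: mon_span_def weight_ge_def)
    have lam1: "lookup lam 1 \<le> lookup lam n" using partition_le[OF lam, of 1 n] n by simp
    \<comment> \<open>An intersection over no primes would be \<open>UNIV\<close>; a limit index
      ensures that p lies in the polynomial ring.\<close>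
    have "\<exists>j\<le>n. limit_index lam j"
    proof (cases "0 < lookup lam 1")
      case True
      then show ?thesis using n(1) by (auto simp: limit_index_def)
    next
      case False
      then have "n \<noteq> 1" using n(2) by auto
      then show ?thesis using n False by (intro exI[of _ n]) (simp add: limit_index_def)
    qed
    then obtain j where "j \<le> n" "limit_index lam j" by blast
    then have "p \<in> carrier (poly_ring n)" using p[of "{1..j}"] by (auto simp: local_contraction_def)
    then have expo: "\<mu> \<in> expos n" if "\<mu> \<in> keys p" for \<mu> using that by (auto simp: carrier_poly_ring mon_span_def)
    have "k * ?f (card A) \<le> weight A \<mu>" if A: "A \<subseteq> {1..n}" and \<mu>: "\<mu> \<in> keys p" for A \<mu>
    proof (cases "limit_index lam (card A)")
      case True
      then show ?thesis using w A \<mu> by blast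
    next
      case False
      have le: "card A \<le> n" using card_mono[OF _ A] by simp
      show ?thesis
      proof (cases "card A = 0")
        case nz: False
        then have eq: "lookup lam (card A) = lookup lam 1"
          using False by (cases "card A = 1") (auto simp: limit_index_def)
        \<comment> \<open>The inequality of a set with \<lambda>_|A| = \<lambda>_1 is a sum of
          singleton inequalities, which come from Ass(I) if \<lambda>_1 > 0 and are trivial if
          \<lambda>_1 = 0.\<close>
        have "k * lookup lam 1 \<le> lookup \<mu> i" if i: "i \<in> A" for i
        proof (cases "lookup lam 1 = 0")
          case pos: False
          have "{i} \<subseteq> {1..n}" using i A by auto
          moreover have "limit_index lam (card {i})" using pos by (simp add: limit_index_def)
          ultimately show ?thesis using w[of "{i}" \<mu>] \<mu> unfolding prefix_sum_1 by (simp add: weight_def)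
        qed simp
        then have "(\<Sum>i\<in>A. k * lookup lam 1) \<le> weight A \<mu>" unfolding weight_def by (rule sum_mono)
        then show ?thesis using prefix_sum_const[OF lam eq le order_refl] by (simp add: algebra_simps)
      qed simp
    qed
    then show "p \<in> ?J" using expo by (auto simp: mon_span_def contrapolymatroid_def)
  qed
  moreover have "?J \<subseteq> symbolic_power n I k"
    unfolding symbolic_power_def J using subset_local_contraction[of ?J n]
      poly_ideal_closed(2)[OF ideal_mon_span[OF upset_contrapolymatroid]] by blast
  ultimately show ?thesis unfolding J by blast
qed

theorem theorem5p8:
  fixes n :: nat
    and lam :: "nat \<Rightarrow>\<^sub>0 nat"
    and I :: "'k::field mpol set"
    and part :: "nat \<Rightarrow> nat"
    and j' :: nat
  assumes "lam \<in> partitions n"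
    and "lam \<noteq> 0"
    and "I = Sss n {lam}"
    and "part = Poly_Mapping.lookup lam"
    and "j' = Min {i \<in> {1..n}. part i > 0}"
  shows
    "Ass_inf n I =
       (if j' > 1
        then {permute_vars \<sigma> ` vars_ideal n j | \<sigma> j.
                \<sigma> permutes {1..n} \<and> j' \<le> j \<and> j \<le> n}
        else {permute_vars \<sigma> ` vars_ideal n j | \<sigma> j.
                \<sigma> permutes {1..n} \<and> 1 \<le> j \<and> j \<le> n \<and>
                (j = 1 \<or> (j > 1 \<and> part j \<noteq> part 1))}) \<and>
     (if (\<exists>a. \<forall>i\<in>{1..n}. part i = a) \<or>
         (\<forall>i\<in>{1..n}. \<forall>j\<in>{1..n}. i \<noteq> j \<and> part i = part j \<longrightarrow> part i = part 1)
      then astab n I = 1 \<and> dstab n I = 1 \<and>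
           (\<forall>k\<ge>1. ideal_power (poly_ring n) I k = symbolic_power n I k)
      else (let s = Max {j \<in> {2..n}. part 1 < part (j - 1) \<and> part (j - 1) = part j}
            in dstab n I \<le> astab n I \<and> astab n I \<le> min (n - 1) (s * (s - 1) + 1)))"
proof -
  note lam = assms(1) and I = assms(3) and part = assms(4)
  note le = partition_le[OF lam, folded part]
  let ?M = "{i \<in> {1..n}. part i > 0}"
  obtain i0 where "i0 \<in> {1..n}" "0 < lookup lam i0" by (rule nonzero_partition[OF assms(1,2)])
  then have i0M: "i0 \<in> ?M" using part by simp
  then have n: "1 \<le> n" "0 < part n" using le[of i0 n] by auto
  have "j' \<in> ?M" unfolding assms(5) using i0M by (intro Min_in) auto
  then have j'1: "1 \<le> j'" "0 < part j'" by auto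
  have j'_iff: "j' \<le> j \<longleftrightarrow> 0 < part j" if "1 \<le> j" "j \<le> n" for j
  proof
    show "0 < part j" if "j' \<le> j" using le[of j' j] that \<open>j \<le> n\<close> j'1 by simp
    show "j' \<le> j" if "0 < part j" unfolding assms(5) using \<open>1 \<le> j\<close> \<open>j \<le> n\<close> that by (intro Min_le) auto
  qed
  have part1: "0 < part 1 \<longleftrightarrow> j' = 1" using j'_iff[of 1] n j'1 by auto
  \<comment> \<open>A crude stable exponent, enough to identify the limit set in all cases; sharper
    ones follow for \<open>astab\<close>.\<close>
  have "stable_exponent n lam n" using n(1) by (auto simp: stable_exponent_def)
  note Ass_inf = astab_Sss(3)[OF lam I this]
  have Ass1: "Ass_inf n I = {permute_vars \<sigma> ` vars_ideal n j | \<sigma> j. \<sigma> permutes {1..n} \<and> j' \<le> j \<and> j \<le> n}" if "j' > 1"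
    unfolding Ass_inf
  proof (rule limit_primes_eq[symmetric])
    show "j' \<le> j \<and> j \<le> n \<longleftrightarrow> limit_index lam j" if "1 \<le> j" "j \<le> n" for j
      using j'_iff[OF that] part1 \<open>j' > 1\<close> that unfolding limit_index_def part[symmetric] by (cases "j = 1") auto
  qed (use that in auto)
  have Ass2: "Ass_inf n I = {permute_vars \<sigma> ` vars_ideal n j | \<sigma> j.
      \<sigma> permutes {1..n} \<and> 1 \<le> j \<and> j \<le> n \<and> (j = 1 \<or> (j > 1 \<and> part j \<noteq> part 1))}" if "\<not> j' > 1"
    unfolding Ass_inf
  proof (rule limit_primes_eq[symmetric])
    show "1 \<le> j \<and> j \<le> n \<and> (j = 1 \<or> (j > 1 \<and> part j \<noteq> part 1)) \<longleftrightarrow> limit_index lam j" if "1 \<le> j" "j \<le> n" for j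
      using part1 j'1 \<open>\<not> j' > 1\<close> that unfolding limit_index_def part[symmetric] by auto
  qed auto
  have limit_n: "limit_index lam n \<longleftrightarrow> n = 1 \<or> part n \<noteq> part 1"
    using n unfolding limit_index_def part[symmetric] by auto
  have case1: "astab n I = 1 \<and> dstab n I = 1 \<and> (\<forall>k\<ge>1. ideal_power (poly_ring n) I k = symbolic_power n I k)"
    if c: "(\<exists>a. \<forall>i\<in>{1..n}. part i = a) \<or>
         (\<forall>i\<in>{1..n}. \<forall>j\<in>{1..n}. i \<noteq> j \<and> part i = part j \<longrightarrow> part i = part 1)"
  proof -
    have one: "stable_exponent n lam 1"
      unfolding stable_exponent_def
    proof (intro conjI allI impI)
      fix j assume j: "j \<le> n" "limit_index lam j"
      show "j = 1 \<or> lookup lam (j - 1) < lookup lam j \<or> j - 1 \<le> 1"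
      proof (cases "j = 1")
        case False
        then have j1: "1 < j" "part j \<noteq> part 1" using j(2) unfolding limit_index_def part by auto
        then have "\<not> (\<exists>a. \<forall>i\<in>{1..n}. part i = a)" using j(1) n(1) by fastforce
        with c have c2: "\<And>i j. i \<in> {1..n} \<Longrightarrow> j \<in> {1..n} \<Longrightarrow> i \<noteq> j \<Longrightarrow> part i = part j \<Longrightarrow> part i = part 1" by blast
        have "j \<in> {1..n}" "j - 1 \<in> {1..n}" "j \<noteq> j - 1" using j1 j(1) by auto
        then have "part (j - 1) \<noteq> part j" using c2[of j "j - 1"] j1(2) by metis
        moreover have "part (j - 1) \<le> part j" by (rule le) (use j1 j(1) in simp_all)
        ultimately show ?thesis unfolding part by simp
      qed simp
    qed simp
    have as: "astab n I = 1" using astab_Sss(1,2)[OF lam I one] by simp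
    have "dstab n I = 1"
    \<comment> \<open>Either the maximal ideal is associated to all powers and the depth is 0
      throughout, which includes n = 1, or the partition is constant and the ideal is
      principal.\<close>
    proof (cases "limit_index lam n")
      case True
      from dstab_bounds[of 1 n I 0] depth_eq_0_if_limit_index[OF lam I one True] as show ?thesis by simp
    next
      case False
      then have "lookup lam n = lookup lam 1" using limit_n part by simp
      from dstab_bounds[OF order_refl depth_constant_partition[OF lam assms(2) I this]] show ?thesis by simp
    qed
    with as show ?thesis using symbolic_power_Sss[OF lam n(1) _ I one] n(2) part by simp
  qed
  have case2: "dstab n I \<le> astab n I \<and> astab n I \<le> min (n - 1) (s * (s - 1) + 1)"
    if c: "\<not> ((\<exists>a. \<forall>i\<in>{1..n}. part i = a) \<or>
         (\<forall>i\<in>{1..n}. \<forall>j\<in>{1..n}. i \<noteq> j \<and> part i = part j \<longrightarrow> part i = part 1))"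
      and s: "s = Max {j \<in> {2..n}. part 1 < part (j - 1) \<and> part (j - 1) = part j}" for s
  proof -
    let ?S = "{j \<in> {2..n}. part 1 < part (j - 1) \<and> part (j - 1) = part j}"
    obtain a b where ab: "a \<in> {1..n}" "b \<in> {1..n}" "a < b" "part a = part b" "part a \<noteq> part 1"
      using c by (metis linorder_neqE_nat)
    \<comment> \<open>A repeated value at a < b fills the whole interval between them, so it also
      occurs at the adjacent positions b - 1 and b.\<close>
    have "part a \<le> part (b - 1)" "part (b - 1) \<le> part b" "part 1 \<le> part a"
      by (rule le; use ab in simp)+
    then have "b \<in> ?S" using ab by auto
    then have "s \<in> ?S" unfolding s by (intro Max_in) auto
    then have "2 \<le> s" "s \<le> n" by auto
    have stable: "stable_exponent n lam (s - 1)"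
      unfolding stable_exponent_def
    proof (intro conjI allI impI)
      fix j assume j: "j \<le> n" "limit_index lam j"
      show "j = 1 \<or> lookup lam (j - 1) < lookup lam j \<or> j - 1 \<le> s - 1"
      proof (cases "j = 1 \<or> lookup lam (j - 1) < lookup lam j")
        case False
        then have j1: "1 < j" "part j \<noteq> part 1" using j(2) unfolding limit_index_def part by auto
        have "part (j - 1) \<le> part j" "part 1 \<le> part j" by (rule le; use j1 j(1) in simp)+
        then have "part (j - 1) = part j" using False unfolding part by simp
        moreover have "part 1 < part j" using \<open>part 1 \<le> part j\<close> j1(2) by simp
        \<comment> \<open>A limit index that asks for k \<ge> j - 1 belongs to the set whose maximum
          is s, so s - 1 meets all demands.\<close>
        ultimately have "j \<in> ?S" using j1 j(1) by auto
        then have "j \<le> s" unfolding s by (intro Max_ge) auto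
        then have "j - 1 \<le> s - 1" by (rule diff_le_mono)
        then show ?thesis by blast
      qed auto
    qed (use \<open>2 \<le> s\<close> in simp)
    have "part a \<le> part n" by (rule le) (use ab in simp_all)
    then have "part n \<noteq> part 1" using \<open>part 1 \<le> part a\<close> ab(5) by linarith
    then have "limit_index lam n" using limit_n by simp
    with dstab_bounds[OF astab_Sss(2)[OF lam I stable]] depth_eq_0_if_limit_index[OF lam I stable]
    have "dstab n I \<le> astab n I" by blast
    \<comment> \<open>The exponent s - 1 lies below both bounds of the statement: s \<le> n gives
      the first, and s \<ge> 2 gives the second.\<close>
    moreover have "s - 1 \<le> s * (s - 1)" using \<open>2 \<le> s\<close> by simp
    then have "s - 1 \<le> min (n - 1) (s * (s - 1) + 1)"
      by (intro min.boundedI diff_le_mono[OF \<open>s \<le> n\<close>] trans_le_add1)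
    ultimately show ?thesis using astab_Sss(1)[OF lam I stable] by simp
  qed
  show ?thesis using Ass1 Ass2 case1 case2 by (auto simp: Let_def)
qed

end
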